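(* Let $d\ge1$ be an integer, $1/2\le\beta<1$ and $0<\epsilon_0<1$ (a small constant). Then there exists a constant $C$, depending only on $d,\epsilon_0,\beta$, such that the following holds. Let $\lambda\ge 1$, let $\tilde{\mathcal A},\tilde{\mathcal P}>0$, and let $\Phi_\lambda\in C^{d+1}(\mathbb B_1)$ be real-valued and $\psi_\lambda\in C_c^{d+1}(\mathbb B_{1-\epsilon_0})$ (both allowed to depend on $\lambda$) satisfy, for all $x\in\mathbb B_1$, $$|\mathcal D_x^\gamma\psi_\lambda(x)|\le\tilde{\mathcal A}\,\lambda^{|\gamma|\beta},\quad 0\le|\gamma|\le d+1,$$ $$|\mathcal D_x^\gamma\Phi_\lambda(x)|\le\tilde{\mathcal P}\,\lambda^{\beta(|\gamma|-2)},\quad 2\le|\gamma|\le d+1.$$ Suppose that the map $\mathbb B_1\ni x\mapsto\nabla_x\Phi_\lambda(x)$ is injective and $L^\ast(\Phi_\lambda)>0$. Then $$\Bigl|\int_{\mathbb R^d} e^{i\lambda\Phi_\lambda(x)}\psi_\lambda(x)\,dx\Bigr|\le\frac{C}{L^\ast(\Phi_\lambda)}\bigl(1+\tilde{\mathcal P}^{d\beta}\bigr)\tilde{\mathcal A}\,\lambda^{-d(1-\beta)}.$$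
   Context: Notation: $\mathbb B_r=\{x\in\mathbb R^d:|x|<r\}$; $\gamma$ denotes a multi-index; $L^\ast(\Phi)=\inf_{x\in\mathbb B_1}|\det\mathrm H\Phi(x)|$, where $\mathrm H\Phi$ is the Hessian matrix of $\Phi$; $C_c^{k}(\mathbb B_{1-\epsilon_0})$ is the space of $C^k$ functions compactly supported in $\mathbb B_{1-\epsilon_0}$. *)

theory Defs
  imports "HOL-Analysis.Analysis"
begin

definition partial_deriv :: "'d \<Rightarrow> (real ^ 'd \<Rightarrow> 'b::real_normed_vector) \<Rightarrow> real ^ 'd \<Rightarrow> 'b" where
  "partial_deriv i f x = vector_derivative (\<lambda>t. f (x + t *\<^sub>R axis i 1)) (at 0)"

definition partially_differentiable_at ::
    "'d \<Rightarrow> (real ^ 'd \<Rightarrow> 'b::real_normed_vector) \<Rightarrow> real ^ 'd \<Rightarrow> bool" where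
  "partially_differentiable_at i f x \<longleftrightarrow> (\<lambda>t. f (x + t *\<^sub>R axis i 1)) differentiable (at 0)"

(* Meant for open S: then the values of the partial derivatives on S depend only on f restricted to S. *)
primrec Ck_on :: "nat \<Rightarrow> (real ^ 'd \<Rightarrow> 'b::real_normed_vector) \<Rightarrow> (real ^ 'd) set \<Rightarrow> bool" where
  "Ck_on 0 f S \<longleftrightarrow> continuous_on S f"
| "Ck_on (Suc k) f S \<longleftrightarrow> continuous_on S f \<and>
     (\<forall>i. (\<forall>x\<in>S. partially_differentiable_at i f x) \<and> Ck_on k (partial_deriv i f) S)"

definition Cck_in :: "nat \<Rightarrow> (real ^ 'd \<Rightarrow> 'b::real_normed_vector) \<Rightarrow> (real ^ 'd) set \<Rightarrow> bool" where
  "Cck_in k f S \<longleftrightarrow> Ck_on k f UNIV \<and>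
     compact (closure {x. f x \<noteq> 0}) \<and> closure {x. f x \<noteq> 0} \<subseteq> S"

primrec iter_partial :: "'d list \<Rightarrow> (real ^ 'd \<Rightarrow> 'b::real_normed_vector) \<Rightarrow> real ^ 'd \<Rightarrow> 'b" where
  "iter_partial [] f = f"
| "iter_partial (i # is) f = iter_partial is (partial_deriv i f)"

type_synonym 'd multi_index = "'d \<Rightarrow> nat"

definition mi_order :: "'d::finite multi_index \<Rightarrow> nat" where
  "mi_order \<gamma> = (\<Sum>i\<in>UNIV. \<gamma> i)"

(* The index type carries no order, so the partial derivatives are taken along some list in which
   each coordinate i occurs exactly \<gamma> i times (one exists by ex_multi_index_list).  By Schwarz's
   theorem the choice is immaterial for C^k functions and multi-indices of order at most k. *)
definition multi_deriv ::
    "'d::finite multi_index \<Rightarrow> (real ^ 'd \<Rightarrow> 'b::real_normed_vector) \<Rightarrow> real ^ 'd \<Rightarrow> 'b" where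
  "multi_deriv \<gamma> f = iter_partial (SOME is. \<forall>i. count_list is i = \<gamma> i) f"

lemma ex_multi_index_list:
  fixes \<gamma> :: "'d::finite multi_index"
  shows "\<exists>is. \<forall>i. count_list is i = \<gamma> i"
proof -
  have "\<exists>is. \<forall>i. count_list is i = (if i \<in> I then \<gamma> i else 0)" if "finite I" for I :: "'d set"
    using that
  proof (induction I rule: finite_induct)
    case empty
    show ?case by (rule exI[of _ "[]"]) simp
  next
    case (insert j I)
    then obtain "is" where h: "\<forall>i. count_list is i = (if i \<in> I then \<gamma> i else 0)" by blast
    have rep: "count_list (replicate n j) i = (if i = j then n else 0)" for n i
      by (induction n) auto
    show ?case
      by (rule exI[of _ "replicate (\<gamma> j) j @ is"]) (use h insert.hyps rep in auto)
  qed
  from this[of UNIV] show ?thesis by simp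
qed

definition gradient :: "(real ^ 'd \<Rightarrow> real) \<Rightarrow> real ^ 'd \<Rightarrow> real ^ 'd" where
  "gradient f x = (\<chi> i. partial_deriv i f x)"

definition hessian :: "(real ^ 'd \<Rightarrow> real) \<Rightarrow> real ^ 'd \<Rightarrow> real ^ 'd ^ 'd" where
  "hessian f x = (\<chi> i j. partial_deriv i (partial_deriv j f) x)"

definition Lstar :: "(real ^ 'd::finite \<Rightarrow> real) \<Rightarrow> real" where
  "Lstar \<Phi> = (INF x\<in>ball 0 1. \<bar>det (hessian \<Phi> x)\<bar>)"

end

theory Submission
  imports Defs
begin

text \<open>Write \<open>d\<close> for the dimension.  Near a critical point of \<open>\<Phi>\<close> the integrand is only bounded; elsewhere
oscillation makes it small after integration by parts.  The two regimes are separated by a radius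
in gradient space,
\<open>r = max (lam powr (\<beta> - 1)) (sqrt (P / lam))\<close>.
With \<open>\<mu> = lam * r\<close> and \<open>G = \<nabla>\<Phi> / r\<close>, this choice turns the two families of hypotheses into one scale:
since \<open>lam powr \<beta> \<le> \<mu>\<close> and \<open>P \<le> r * \<mu>\<close>, a derivative of order \<open>k\<close> is at most \<open>A * \<mu> ^ k\<close> for \<open>\<psi>\<close>
(\<open>k \<le> d + 1\<close>) and at most \<open>\<mu> ^ k\<close> for \<open>G\<close> (\<open>1 \<le> k \<le> d\<close>).

Let \<open>w = (1 + |G|^2) powr (- 1 / 2)\<close> and \<open>b = w^2 G\<close>.  The first-order operator
\<open>w^2 - (\<i> / \<mu>) b \<cdot> \<nabla>\<close> fixes \<open>exp (\<i> lam \<Phi>)\<close>, so under the integral an amplitude \<open>f\<close> may be replaced by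
\<open>w^2 f + (\<i> / \<mu>) (b \<cdot> \<nabla>f + (div b) f)\<close>.
There is no cut-off and no singularity at critical points.  Every derivative costs a factor \<open>\<mu>\<close>,
which \<open>1 / \<mu>\<close> cancels, and each of the three terms gains at least one factor \<open>w\<close> over \<open>f\<close>.

Applying this \<open>d + 1\<close> times naively would need \<open>d + 1\<close> derivatives of \<open>G\<close>, one more than \<open>\<Phi>\<close> has.  But
the term \<open>(div b) f\<close>, the only one in which \<open>G\<close> is differentiated, gains \<open>w^2\<close> instead of \<open>w\<close>.
If an amplitude has \<open>j\<close> controlled derivatives and decays like \<open>w ^ p\<close>, the inequality
\<open>d + 1 \<le> j + p\<close> is therefore preserved by each step (lemma \<open>decay\<close>), and the iteration ends with
\<open>|integral| \<le> const * A * (integral of w ^ (d + 1))\<close>.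

Finally \<open>\<nabla>\<Phi>\<close> is injective with Jacobian at least \<open>L\<^sup>*(\<Phi>)\<close>, so the set where \<open>|G| < R\<close>
has volume at most a constant times \<open>(r * R) ^ d / L\<^sup>*(\<Phi>)\<close>, and summing over dyadic \<open>R\<close> bounds the
integral of \<open>w ^ (d + 1)\<close> by a constant times \<open>r ^ d / L\<^sup>*(\<Phi>)\<close> (lemma \<open>mass_le\<close>).  Because \<open>\<beta> \<ge> 1 / 2\<close>, the power
\<open>r ^ d\<close> is at most \<open>2 (1 + P powr (d \<beta>)) lam powr (- d (1 - \<beta>))\<close> (lemma \<open>scale_power_le\<close>).\<close>

section \<open>Partial derivatives\<close>

definition has_partial :: "'d \<Rightarrow> (real ^ 'd \<Rightarrow> 'b::real_normed_vector) \<Rightarrow> 'b \<Rightarrow> real ^ 'd \<Rightarrow> bool" where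
  "has_partial i f D x \<longleftrightarrow> ((\<lambda>t. f (x + t *\<^sub>R axis i 1)) has_vector_derivative D) (at 0)"

lemma has_partial_iff:
  "has_partial i f D x \<longleftrightarrow> partially_differentiable_at i f x \<and> partial_deriv i f x = D"
  unfolding has_partial_def partially_differentiable_at_def partial_deriv_def
  by (metis differentiableI_vector vector_derivative_at vector_derivative_works)

lemma has_partial_cong_open:
  assumes "has_partial i f D x" "open S" "x \<in> S" "\<And>y. y \<in> S \<Longrightarrow> f y = g y"
  shows "has_partial i g D x"
  unfolding has_partial_def
proof (rule has_vector_derivative_transform_within_open)
  show "((\<lambda>t. f (x + t *\<^sub>R axis i 1)) has_vector_derivative D) (at 0)"
    using assms(1) by (simp add: has_partial_def)
  show "open ((\<lambda>t. x + t *\<^sub>R axis i 1) -` S)"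
    by (intro open_vimage assms continuous_intros)
qed (use assms in auto)

lemma has_partial_along_line:
  assumes "has_partial i f D (x + s *\<^sub>R axis i 1)"
  shows "((\<lambda>t. f (x + t *\<^sub>R axis i 1)) has_vector_derivative D) (at s)"
proof -
  have "((\<lambda>t. t - s) has_vector_derivative 1) (at s)"
    by (auto intro!: derivative_eq_intros)
  from vector_diff_chain_at[OF this, of "\<lambda>u. f (x + s *\<^sub>R axis i 1 + u *\<^sub>R axis i 1)" D] assms
  show ?thesis by (simp add: has_partial_def o_def algebra_simps flip: scaleR_add_left)
qed

lemma has_partial_add:
  "has_partial i f D x \<Longrightarrow> has_partial i g E x \<Longrightarrow> has_partial i (\<lambda>y. f y + g y) (D + E) x"
  unfolding has_partial_def by (rule has_vector_derivative_add)

lemma has_partial_sum: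
  "(\<And>a. a \<in> A \<Longrightarrow> has_partial i (f a) (D a) x) \<Longrightarrow> has_partial i (\<lambda>y. \<Sum>a\<in>A. f a y) (\<Sum>a\<in>A. D a) x"
  unfolding has_partial_def by (rule has_vector_derivative_sum)

lemma has_partial_const: "has_partial i (\<lambda>y. c) 0 x"
  unfolding has_partial_def by (rule has_vector_derivative_const)

lemma has_partial_linear:
  assumes "bounded_linear L" "has_partial i f D x"
  shows "has_partial i (\<lambda>y. L (f y)) (L D) x"
  using assms unfolding has_partial_def by (rule bounded_linear.has_vector_derivative)

lemma has_partial_scaleR:
  assumes "has_partial i f D x" "has_partial i g E x"
  shows "has_partial i (\<lambda>y. f y *\<^sub>R g y) (f x *\<^sub>R E + D *\<^sub>R g x) x"
  using has_vector_derivative_scaleR[of "\<lambda>t. f (x + t *\<^sub>R axis i 1)" D 0 UNIV] assms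
  unfolding has_partial_def has_real_derivative_iff_has_vector_derivative[symmetric]
  by fastforce

lemma has_partial_mult:
  fixes f g :: "real ^ 'd \<Rightarrow> 'b::real_normed_algebra"
  assumes "has_partial i f D x" "has_partial i g E x"
  shows "has_partial i (\<lambda>y. f y * g y) (f x * E + D * g x) x"
  using has_vector_derivative_mult[of "\<lambda>t. f (x + t *\<^sub>R axis i 1)" D 0 UNIV] assms
  unfolding has_partial_def by fastforce

lemma has_partial_inverse:
  fixes f :: "real ^ 'd \<Rightarrow> real"
  assumes "has_partial i f D x" "f x \<noteq> 0"
  shows "has_partial i (\<lambda>y. inverse (f y)) (- (inverse (f x) * D * inverse (f x))) x"
  using DERIV_inverse'[of "\<lambda>t. f (x + t *\<^sub>R axis i 1)" D 0 UNIV] assms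
  unfolding has_partial_def has_real_derivative_iff_has_vector_derivative[symmetric]
  by fastforce

lemma partial_deriv_cong_open:
  assumes "open S" "x \<in> S" "\<And>y. y \<in> S \<Longrightarrow> f y = g y"
    "partially_differentiable_at i f x"
  shows "partially_differentiable_at i g x" "partial_deriv i f x = partial_deriv i g x"
proof -
  have "has_partial i g (partial_deriv i f x) x"
    by (rule has_partial_cong_open[OF _ assms(1-3)]) (simp_all add: has_partial_iff assms(4))
  then show "partially_differentiable_at i g x" "partial_deriv i f x = partial_deriv i g x"
    by (auto simp: has_partial_iff)
qed

lemma Ck_on_Suc_has_partial:
  "Ck_on (Suc k) f S \<Longrightarrow> x \<in> S \<Longrightarrow> has_partial i f (partial_deriv i f x) x"
  by (simp add: has_partial_iff)

lemma Ck_on_continuous: "Ck_on k f S \<Longrightarrow> continuous_on S f"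
  by (cases k) auto

lemma Ck_on_mono: "Ck_on n f S \<Longrightarrow> m \<le> n \<Longrightarrow> Ck_on m f S"
proof (induction m arbitrary: n f)
  case 0
  then show ?case using Ck_on_continuous by auto
next
  case (Suc m)
  then obtain n' where "n = Suc n'" by (cases n) auto
  with Suc show ?case by auto
qed

lemma Ck_on_subset: "Ck_on k f S \<Longrightarrow> T \<subseteq> S \<Longrightarrow> Ck_on k f T"
proof (induction k arbitrary: f)
  case (Suc k)
  then show ?case by (auto intro: continuous_on_subset)
qed (auto intro: continuous_on_subset)

section \<open>Symmetry of iterated partial derivatives\<close>

lemma partial_mean_value:
  fixes f :: "real ^ 'd \<Rightarrow> real"
  assumes "\<And>s. s \<in> {0..h} \<Longrightarrow> has_partial i f (D s) (x + s *\<^sub>R axis i 1)" "0 < h"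
  shows "\<exists>z\<in>{0<..<h}. f (x + h *\<^sub>R axis i 1) - f x = h * D z"
proof -
  have "((\<lambda>t. f (x + t *\<^sub>R axis i 1)) has_real_derivative D s) (at s)" if "0 \<le> s" "s \<le> h" for s
    using has_partial_along_line[OF assms(1)[of s]] that
    by (simp add: has_real_derivative_iff_has_vector_derivative)
  from MVT2[OF assms(2) this] show ?thesis by force
qed

text \<open>Applying the mean value theorem first in direction \<open>i\<close> and then in direction \<open>j\<close> evaluates the
second difference over a small square as \<open>h^2\<close> times a mixed derivative at a point of that
square.  The second difference is symmetric in \<open>i\<close> and \<open>j\<close>, which yields Schwarz's theorem.\<close>

lemma second_difference:
  fixes f :: "real ^ 'd::finite \<Rightarrow> real"
  assumes S: "\<And>s t. s \<in> {0..h} \<Longrightarrow> t \<in> {0..h} \<Longrightarrow> x + s *\<^sub>R axis i 1 + t *\<^sub>R axis j 1 \<in> S"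
    and fi: "\<And>y. y \<in> S \<Longrightarrow> has_partial i f (fi y) y"
    and fij: "\<And>y. y \<in> S \<Longrightarrow> has_partial j fi (fij y) y"
    and h: "0 < h"
  shows "\<exists>s\<in>{0<..<h}. \<exists>t\<in>{0<..<h}.
     f (x + h *\<^sub>R axis i 1 + h *\<^sub>R axis j 1) - f (x + h *\<^sub>R axis j 1) - (f (x + h *\<^sub>R axis i 1) - f x)
       = h * (h * fij (x + s *\<^sub>R axis i 1 + t *\<^sub>R axis j 1))"
proof -
  let ?i = "axis i 1 :: real ^ 'd" and ?j = "axis j 1 :: real ^ 'd"
  have shift: "has_partial i (\<lambda>y. f (y + h *\<^sub>R ?j)) (fi (y + h *\<^sub>R ?j)) y" if "y + h *\<^sub>R ?j \<in> S" for y
    using fi[OF that] by (simp add: has_partial_def add.assoc add.left_commute add.commute)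
  have "\<exists>s\<in>{0<..<h}. (f (x + h *\<^sub>R ?i + h *\<^sub>R ?j) - f (x + h *\<^sub>R ?i)) - (f (x + h *\<^sub>R ?j) - f x)
      = h * (fi (x + s *\<^sub>R ?i + h *\<^sub>R ?j) - fi (x + s *\<^sub>R ?i))"
  proof (rule partial_mean_value[OF _ h])
    fix s assume s: "s \<in> {0..h}"
    have "has_partial i (\<lambda>y. f (y + h *\<^sub>R ?j) + (- f y)) (fi (x + s *\<^sub>R ?i + h *\<^sub>R ?j) + (- fi (x + s *\<^sub>R ?i))) (x + s *\<^sub>R ?i)"
    proof (intro has_partial_add shift)
      show "x + s *\<^sub>R ?i + h *\<^sub>R ?j \<in> S" using S[of s h] s h by auto
      show "has_partial i (\<lambda>y. - f y) (- fi (x + s *\<^sub>R ?i)) (x + s *\<^sub>R ?i)"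
        by (rule has_partial_linear[OF bounded_linear_minus[OF bounded_linear_ident] fi])
           (use S[of s 0] s h in auto)
    qed
    then show "has_partial i (\<lambda>y. f (y + h *\<^sub>R ?j) - f y) (fi (x + s *\<^sub>R ?i + h *\<^sub>R ?j) - fi (x + s *\<^sub>R ?i)) (x + s *\<^sub>R ?i)"
      by simp
  qed
  then obtain s where s: "s \<in> {0<..<h}"
    "(f (x + h *\<^sub>R ?i + h *\<^sub>R ?j) - f (x + h *\<^sub>R ?i)) - (f (x + h *\<^sub>R ?j) - f x)
      = h * (fi (x + s *\<^sub>R ?i + h *\<^sub>R ?j) - fi (x + s *\<^sub>R ?i))"
    by blast
  have "\<exists>t\<in>{0<..<h}. fi (x + s *\<^sub>R ?i + h *\<^sub>R ?j) - fi (x + s *\<^sub>R ?i) = h * fij (x + s *\<^sub>R ?i + t *\<^sub>R ?j)"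
    by (rule partial_mean_value[OF _ h]) (use S s fij in auto)
  then obtain t where t: "t \<in> {0<..<h}"
    "fi (x + s *\<^sub>R ?i + h *\<^sub>R ?j) - fi (x + s *\<^sub>R ?i) = h * fij (x + s *\<^sub>R ?i + t *\<^sub>R ?j)"
    by blast
  have "f (x + h *\<^sub>R ?i + h *\<^sub>R ?j) - f (x + h *\<^sub>R ?j) - (f (x + h *\<^sub>R ?i) - f x)
      = h * (h * fij (x + s *\<^sub>R ?i + t *\<^sub>R ?j))"
    using s(2) unfolding t(2) by linarith
  with s(1) t(1) show ?thesis by blast
qed

lemma mixed_partials_commute_real:
  fixes f :: "real ^ 'd::finite \<Rightarrow> real"
  assumes S: "open S" "x \<in> S"
    and fi: "\<And>y. y \<in> S \<Longrightarrow> has_partial i f (fi y) y"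
    and fj: "\<And>y. y \<in> S \<Longrightarrow> has_partial j f (fj y) y"
    and fij: "\<And>y. y \<in> S \<Longrightarrow> has_partial j fi (fij y) y"
    and fji: "\<And>y. y \<in> S \<Longrightarrow> has_partial i fj (fji y) y"
    and cont: "continuous_on S fij" "continuous_on S fji"
  shows "fij x = fji x"
proof (rule ccontr)
  assume ne: "fij x \<noteq> fji x"
  define e where "e = \<bar>fij x - fji x\<bar> / 2"
  have e: "e > 0" using ne by (simp add: e_def)
  have "\<forall>\<^sub>F y in at x. \<bar>fij y - fij x\<bar> < e" "\<forall>\<^sub>F y in at x. \<bar>fji y - fji x\<bar> < e"
    using cont[unfolded continuous_on_eq_continuous_at[OF S(1)], rule_format, OF S(2)] e
    by (auto simp: isCont_def dist_real_def dest!: tendstoD)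
  moreover have "\<forall>\<^sub>F y in at x. y \<in> S"
    using S by (simp add: eventually_at_in_open')
  ultimately have "\<forall>\<^sub>F y in at x. \<bar>fij y - fij x\<bar> < e \<and> \<bar>fji y - fji x\<bar> < e \<and> y \<in> S"
    by eventually_elim auto
  then obtain \<delta> where \<delta>0: "\<delta> > 0" "\<forall>y. y \<noteq> x \<and> dist y x < \<delta> \<longrightarrow> \<bar>fij y - fij x\<bar> < e \<and> \<bar>fji y - fji x\<bar> < e \<and> y \<in> S"
    unfolding eventually_at by blast
  have \<delta>: "\<delta> > 0" "\<And>y. dist y x < \<delta> \<Longrightarrow> \<bar>fij y - fij x\<bar> < e \<and> \<bar>fji y - fji x\<bar> < e \<and> y \<in> S"
    subgoal by (rule \<delta>0(1))
    subgoal for y using \<delta>0(2) e S(2) by (cases "y = x") auto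
    done
  \<comment> \<open>Two steps of length at most \<open>h\<close> along the axes then stay inside the ball of radius \<open>\<delta>\<close>.\<close>
  define h where "h = \<delta> / 4"
  have h: "h > 0" using \<delta> by (simp add: h_def)
  have near: "dist (x + s *\<^sub>R axis k 1 + t *\<^sub>R axis l 1) x < \<delta>" if "s \<in> {0..h}" "t \<in> {0..h}" for s t k l
  proof -
    have "norm (s *\<^sub>R axis k 1 + t *\<^sub>R axis l (1::real) :: real ^ 'd) \<le> norm (s *\<^sub>R axis k 1 :: real ^ 'd) + norm (t *\<^sub>R axis l 1 :: real ^ 'd)"
      by (rule norm_triangle_ineq)
    also have "\<dots> < \<delta>" using that \<delta>(1) by (simp add: h_def)
    finally show ?thesis by (simp add: dist_norm add.assoc)
  qed
  obtain s t where 1: "s \<in> {0<..<h}" "t \<in> {0<..<h}"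
    "f (x + h *\<^sub>R axis i 1 + h *\<^sub>R axis j 1) - f (x + h *\<^sub>R axis j 1) - (f (x + h *\<^sub>R axis i 1) - f x)
       = h * (h * fij (x + s *\<^sub>R axis i 1 + t *\<^sub>R axis j 1))"
    using second_difference[of h x i j S f fi fij, OF _ fi fij h] near \<delta>(2) by blast
  obtain s' t' where 2: "s' \<in> {0<..<h}" "t' \<in> {0<..<h}"
    "f (x + h *\<^sub>R axis j 1 + h *\<^sub>R axis i 1) - f (x + h *\<^sub>R axis i 1) - (f (x + h *\<^sub>R axis j 1) - f x)
       = h * (h * fji (x + s' *\<^sub>R axis j 1 + t' *\<^sub>R axis i 1))"
    using second_difference[of h x j i S f fj fji, OF _ fj fji h] near \<delta>(2) by blast
  have sw: "x + h *\<^sub>R axis j 1 + h *\<^sub>R axis i 1 = x + h *\<^sub>R axis i 1 + h *\<^sub>R axis j 1"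
    by (simp add: add.assoc add.left_commute add.commute)
  have "h * (h * fij (x + s *\<^sub>R axis i 1 + t *\<^sub>R axis j 1)) = h * (h * fji (x + s' *\<^sub>R axis j 1 + t' *\<^sub>R axis i 1))"
    using 1(3) 2(3) unfolding sw by linarith
  then have "fij (x + s *\<^sub>R axis i 1 + t *\<^sub>R axis j 1) = fji (x + s' *\<^sub>R axis j 1 + t' *\<^sub>R axis i 1)"
    using h by simp
  moreover have "\<bar>fij (x + s *\<^sub>R axis i 1 + t *\<^sub>R axis j 1) - fij x\<bar> < e"
    "\<bar>fji (x + s' *\<^sub>R axis j 1 + t' *\<^sub>R axis i 1) - fji x\<bar> < e"
    using \<delta>(2)[OF near] 1 2 by auto
  ultimately have "\<bar>fij x - fji x\<bar> < e + e" by linarith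
  then show False by (simp add: e_def)
qed

text \<open>The mean value theorem needs real values; testing against every vector \<open>v\<close> by the inner product
reduces the general case to that one.\<close>

lemma mixed_partials_commute:
  fixes f :: "real ^ 'd::finite \<Rightarrow> 'b::real_inner"
  assumes "Ck_on (Suc (Suc k)) f S" "open S" "x \<in> S"
  shows "partial_deriv i (partial_deriv j f) x = partial_deriv j (partial_deriv i f) x"
proof -
  have c: "Ck_on (Suc k) (partial_deriv l f) S" "Ck_on k (partial_deriv m (partial_deriv l f)) S" for l m
    using assms(1) by auto
  have "partial_deriv i (partial_deriv j f) x \<bullet> v = partial_deriv j (partial_deriv i f) x \<bullet> v" for v
  proof (rule mixed_partials_commute_real[OF assms(2,3)])
    note L = has_partial_linear[OF bounded_linear_inner_left[of v]]
    fix y assume y: "y \<in> S"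
    show "has_partial j (\<lambda>y. f y \<bullet> v) (partial_deriv j f y \<bullet> v) y" "has_partial i (\<lambda>y. f y \<bullet> v) (partial_deriv i f y \<bullet> v) y"
      by (rule L, rule Ck_on_Suc_has_partial[OF assms(1) y])+
    show "has_partial i (\<lambda>y. partial_deriv j f y \<bullet> v) (partial_deriv i (partial_deriv j f) y \<bullet> v) y"
      "has_partial j (\<lambda>y. partial_deriv i f y \<bullet> v) (partial_deriv j (partial_deriv i f) y \<bullet> v) y"
      by (rule L, rule Ck_on_Suc_has_partial[OF c(1) y])+
  qed (intro continuous_intros Ck_on_continuous[OF c(2)])+
  then show ?thesis by (metis vector_eq_rdot)
qed

lemma iter_partial_append: "iter_partial (is @ js) f = iter_partial js (iter_partial is f)"
  by (induction "is" arbitrary: f) auto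

lemma iter_partial_cong_open:
  assumes "open S" "\<And>y. y \<in> S \<Longrightarrow> f y = g y" "Ck_on (length is) f S" "x \<in> S"
  shows "iter_partial is f x = iter_partial is g x"
  using assms
proof (induction "is" arbitrary: f g)
  case (Cons i "is")
  have "partial_deriv i f y = partial_deriv i g y" if "y \<in> S" for y
    by (rule partial_deriv_cong_open(2)[OF Cons.prems(1) that Cons.prems(2)]) (use Cons.prems that in auto)
  from Cons.IH[OF Cons.prems(1) this] show ?case using Cons.prems by simp
qed auto

lemma iter_partial_move_front:
  fixes f :: "real ^ 'd::finite \<Rightarrow> 'b::real_inner"
  assumes "open S" "Ck_on (length xs + length ys + 1) f S" "x \<in> S"
  shows "iter_partial (xs @ a # ys) f x = iter_partial (a # xs @ ys) f x"
  using assms(2)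
proof (induction xs arbitrary: f)
  case (Cons b xs)
  have "iter_partial ((b # xs) @ a # ys) f x = iter_partial (a # xs @ ys) (partial_deriv b f) x"
    using Cons.IH[of "partial_deriv b f"] Cons.prems by simp
  also have "\<dots> = iter_partial (xs @ ys) (partial_deriv a (partial_deriv b f)) x" by simp
  also have "\<dots> = iter_partial (xs @ ys) (partial_deriv b (partial_deriv a f)) x"
  proof (rule iter_partial_cong_open[OF assms(1)])
    show "partial_deriv a (partial_deriv b f) y = partial_deriv b (partial_deriv a f) y" if "y \<in> S" for y
      by (rule mixed_partials_commute[of "length xs + length ys", OF _ assms(1) that]) (use Cons.prems in simp)
  qed (use Cons.prems assms(3) in auto)
  finally show ?case by simp
qed simp

text \<open>\<open>multi_deriv\<close> differentiates along an unspecified list with the prescribed multiplicities, so its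
bounds can be transferred to a concrete list of directions only through this independence of order.\<close>

lemma iter_partial_perm:
  fixes f :: "real ^ 'd::finite \<Rightarrow> 'b::real_inner"
  assumes "open S" "Ck_on (length xs) f S" "x \<in> S" "mset xs = mset ys"
  shows "iter_partial xs f x = iter_partial ys f x"
  using assms(2,4)
proof (induction xs arbitrary: f ys)
  case (Cons a xs)
  then have "a \<in> set ys" by (metis list.set_intros(1) set_mset_mset)
  then obtain us vs where ys: "ys = us @ a # vs" by (meson split_list)
  have m: "mset xs = mset (us @ vs)" using Cons.prems(2) ys by simp
  then have len: "length xs = length us + length vs" by (metis length_append size_mset)
  have "iter_partial (a # xs) f x = iter_partial (us @ vs) (partial_deriv a f) x"
    using Cons.IH[OF _ m, of "partial_deriv a f"] Cons.prems by simp
  also have "\<dots> = iter_partial ys f x"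
    unfolding ys by (subst iter_partial_move_front[OF assms(1) _ assms(3)]) (use Cons.prems len in simp_all)
  finally show ?case .
qed simp

lemma multi_deriv_list:
  fixes f :: "real ^ 'd::finite \<Rightarrow> 'b::real_inner"
  assumes "open S" "Ck_on (length is) f S" "x \<in> S"
  shows "multi_deriv (count_list is) f x = iter_partial is f x"
proof -
  define js where "js = (SOME js. \<forall>i. count_list js i = count_list is i)"
  have "\<forall>i. count_list js i = count_list is i"
    unfolding js_def by (rule someI[of _ "is"]) simp
  then have "mset is = mset js" by (intro multiset_eqI) (simp add: count_mset)
  from iter_partial_perm[OF assms this] show ?thesis
    by (simp add: multi_deriv_def js_def)
qed

lemma mi_order_count_list: "mi_order (count_list is) = length is"
  unfolding mi_order_def by (rule sum_count_set) auto

section \<open>Frechet differentiability from continuous partial derivatives\<close>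

text \<open>The increment is built up one coordinate at a time, and each single step is controlled by the mean
value inequality.  The induction runs over the finite set of coordinates already moved, because
the index type carries no order.\<close>

lemma has_derivative_of_continuous_partials:
  fixes f :: "real ^ 'd::finite \<Rightarrow> real"
  assumes S: "open S" "x \<in> S"
    and p: "\<And>i y. y \<in> S \<Longrightarrow> has_partial i f (f' i y) y"
    and c: "\<And>i. continuous_on S (f' i)"
  shows "(f has_derivative (\<lambda>v. \<Sum>i\<in>UNIV. v $ i * f' i x)) (at x)"
  unfolding has_derivative_at_alt
proof (intro conjI allI impI)
  show "bounded_linear (\<lambda>v :: real ^ 'd. \<Sum>i\<in>UNIV. v $ i * f' i x)"
    by (intro bounded_linear_sum bounded_linear_mult_left[THEN bounded_linear_compose] bounded_linear_vec_nth)
  fix e :: real assume "e > 0"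
  define \<epsilon> where "\<epsilon> = e / real CARD('d)"
  have \<epsilon>: "\<epsilon> > 0" using \<open>e > 0\<close> by (simp add: \<epsilon>_def)
  have "\<forall>\<^sub>F y in at x. \<bar>f' i y - f' i x\<bar> < \<epsilon>" for i
    using c[unfolded continuous_on_eq_continuous_at[OF S(1)], rule_format, OF S(2), of i] \<epsilon>
    by (auto simp: isCont_def dist_real_def dest!: tendstoD)
  then have "\<forall>\<^sub>F y in at x. \<forall>i\<in>UNIV. \<bar>f' i y - f' i x\<bar> < \<epsilon>"
    by (intro eventually_ball_finite) auto
  moreover have "\<forall>\<^sub>F y in at x. y \<in> S"
    using S by (simp add: eventually_at_in_open')
  ultimately have "\<forall>\<^sub>F y in at x. (\<forall>i\<in>UNIV. \<bar>f' i y - f' i x\<bar> < \<epsilon>) \<and> y \<in> S"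
    by eventually_elim auto
  then obtain \<delta> where \<delta>0: "\<delta> > 0" "\<forall>y. y \<noteq> x \<and> dist y x < \<delta> \<longrightarrow> (\<forall>i\<in>UNIV. \<bar>f' i y - f' i x\<bar> < \<epsilon>) \<and> y \<in> S"
    unfolding eventually_at by blast
  have \<delta>: "\<delta> > 0" "\<And>y i. dist y x < \<delta> \<Longrightarrow> \<bar>f' i y - f' i x\<bar> < \<epsilon> \<and> y \<in> S"
    subgoal by (rule \<delta>0(1))
    subgoal for y using \<delta>0(2) \<epsilon> S(2) by (cases "y = x") auto
    done
  show "\<exists>d>0. \<forall>y. norm (y - x) < d \<longrightarrow>
      norm (f y - f x - (\<Sum>i\<in>UNIV. (y - x) $ i * f' i x)) \<le> e * norm (y - x)"
  proof (intro exI conjI allI impI)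
    fix y assume y: "norm (y - x) < \<delta>"
    define q where "q I = x + (\<Sum>i\<in>I. (y - x) $ i *\<^sub>R axis i (1::real))" for I
    \<comment> \<open>The point \<open>q I\<close> agrees with \<open>y\<close> in the coordinates from \<open>I\<close> and with \<open>x\<close> in the others.\<close>
    have comp: "(q I - x) $ k = (if k \<in> I then (y - x) $ k else 0)" for I k
      by (simp add: q_def axis_def sum.If_cases if_distrib cong: if_cong)
    have "\<bar>f (q I) - f x - (\<Sum>i\<in>I. (y - x) $ i * f' i x)\<bar> \<le> card I * (\<epsilon> * norm (y - x))" for I
    proof (induction I rule: infinite_finite_induct)
      case (insert j I)
      let ?a = "(y - x) $ j"
      have qj: "q (insert j I) = q I + ?a *\<^sub>R axis j 1"
        using insert.hyps by (simp add: q_def)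
      have near: "norm (q I + s *\<^sub>R axis j 1 - x) < \<delta>" if "\<bar>s\<bar> \<le> \<bar>?a\<bar>" for s
      proof -
        have "norm (q I + s *\<^sub>R axis j 1 - x) \<le> norm (y - x)"
        proof (rule norm_le_componentwise_cart)
          fix k
          have "(q I + s *\<^sub>R axis j 1 - x) $ k = (q I - x) $ k + s * axis j 1 $ k" by simp
          then show "norm ((q I + s *\<^sub>R axis j 1 - x) $ k) \<le> norm ((y - x) $ k)"
            unfolding comp using that insert.hyps by (auto simp: axis_def)
        qed
        with y show ?thesis by simp
      qed
      have "\<bar>f (q I + ?a *\<^sub>R axis j 1) - f (q I) - ?a * f' j x\<bar> \<le> \<epsilon> * norm (y - x)"
      proof -
        let ?F = "\<lambda>t. f (q I + t *\<^sub>R axis j 1) - t * f' j x"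
        have der: "(?F has_real_derivative (f' j (q I + t *\<^sub>R axis j 1) - f' j x)) (at t within {- \<bar>?a\<bar>..\<bar>?a\<bar>})"
          if "t \<in> {- \<bar>?a\<bar>..\<bar>?a\<bar>}" for t
        proof -
          have "q I + t *\<^sub>R axis j 1 \<in> S"
            using \<delta>(2) near[of t] that by (auto simp: dist_norm)
          from has_partial_along_line[OF p[OF this]]
          have "((\<lambda>t. f (q I + t *\<^sub>R axis j 1)) has_real_derivative f' j (q I + t *\<^sub>R axis j 1)) (at t within {- \<bar>?a\<bar>..\<bar>?a\<bar>})"
            by (simp add: has_real_derivative_iff_has_vector_derivative has_vector_derivative_at_within)
          then show ?thesis by (auto intro!: derivative_eq_intros)
        qed
        have "norm (?F ?a - ?F 0) \<le> \<epsilon> * norm (?a - 0)"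
        proof (rule field_differentiable_bound[OF _ der])
          fix t assume "t \<in> {- \<bar>?a\<bar>..\<bar>?a\<bar>}"
          then show "norm (f' j (q I + t *\<^sub>R axis j 1) - f' j x) \<le> \<epsilon>"
            using \<delta>(2)[of "q I + t *\<^sub>R axis j 1" j] near[of t] by (auto simp: dist_norm)
        qed auto
        also have "\<dots> \<le> \<epsilon> * norm (y - x)"
          using \<epsilon> component_le_norm_cart[of "y - x" j] by simp
        finally show ?thesis by (simp add: algebra_simps)
      qed
      with insert show ?case
        by (simp add: qj algebra_simps)
    qed (auto simp: q_def)
    from this[of UNIV] have "\<bar>f (q UNIV) - f x - (\<Sum>i\<in>UNIV. (y - x) $ i * f' i x)\<bar> \<le> e * norm (y - x)"
      by (simp add: \<epsilon>_def)
    moreover have "q UNIV = y"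
      using comp[of UNIV] by (simp add: vec_eq_iff)
    ultimately show "norm (f y - f x - (\<Sum>i\<in>UNIV. (y - x) $ i * f' i x)) \<le> e * norm (y - x)"
      by simp
  qed (rule \<delta>(1))
qed

section \<open>Weighted bounds on all derivatives up to a given order\<close>

text \<open>\<open>jet_bound \<mu> U k W f\<close> expresses that \<open>f\<close> is of class \<open>C^k\<close> on \<open>U\<close> and that its derivatives of order
\<open>n \<le> k\<close> are bounded by \<open>\<mu> ^ n * W\<close>.  The weight is a function, so that decay in the size of the
gradient and all numerical constants are carried in one argument; weights then add under sums and
multiply, up to \<open>2 ^ k\<close>, under products.\<close>

primrec jet_bound ::
    "real \<Rightarrow> (real ^ 'd) set \<Rightarrow> nat \<Rightarrow> (real ^ 'd \<Rightarrow> real) \<Rightarrow> (real ^ 'd \<Rightarrow> 'b::real_normed_vector) \<Rightarrow> bool" where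
  "jet_bound \<mu> U 0 W f \<longleftrightarrow> continuous_on U f \<and> (\<forall>x\<in>U. norm (f x) \<le> W x)"
| "jet_bound \<mu> U (Suc k) W f \<longleftrightarrow> continuous_on U f \<and> (\<forall>x\<in>U. norm (f x) \<le> W x) \<and>
     (\<forall>i. (\<forall>x\<in>U. partially_differentiable_at i f x) \<and> jet_bound \<mu> U k (\<lambda>x. \<mu> * W x) (partial_deriv i f))"

lemma jet_boundD:
  assumes "jet_bound \<mu> U k W f"
  shows "continuous_on U f" "x \<in> U \<Longrightarrow> norm (f x) \<le> W x"
  using assms by (cases k; auto)+

lemma jet_bound_nonneg: "jet_bound \<mu> U k W f \<Longrightarrow> x \<in> U \<Longrightarrow> 0 \<le> W x"
  using jet_boundD(2) norm_ge_zero order_trans by blast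

lemma jet_bound_SucD:
  assumes "jet_bound \<mu> U (Suc k) W f"
  shows "x \<in> U \<Longrightarrow> has_partial i f (partial_deriv i f x) x"
    and "jet_bound \<mu> U k (\<lambda>x. \<mu> * W x) (partial_deriv i f)"
  using assms by (auto simp: has_partial_iff)

lemma jet_bound_cong:
  assumes "open U" "jet_bound \<mu> U k W f" "\<And>x. x \<in> U \<Longrightarrow> f x = g x"
  shows "jet_bound \<mu> U k W g"
  using assms(2,3)
proof (induction k arbitrary: W f g)
  case 0
  then show ?case by (auto cong: continuous_on_cong)
next
  case (Suc k)
  have "continuous_on U g" using jet_boundD(1)[OF Suc.prems(1)] Suc.prems(2)
    by (simp cong: continuous_on_cong)
  moreover have "norm (g x) \<le> W x" if "x \<in> U" for x
    using jet_boundD(2)[OF Suc.prems(1) that] Suc.prems(2)[OF that] by simp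
  moreover have "partially_differentiable_at i g x" "partial_deriv i f x = partial_deriv i g x" if "x \<in> U" for i x
    using partial_deriv_cong_open[OF assms(1) that Suc.prems(2)] Suc.prems(1) that by auto
  moreover have "jet_bound \<mu> U k (\<lambda>x. \<mu> * W x) (partial_deriv i g)" for i
    by (rule Suc.IH[OF jet_bound_SucD(2)[OF Suc.prems(1)]]) (rule calculation(4))
  ultimately show ?case by simp
qed

lemma jet_bound_SucI:
  assumes "open U" "continuous_on U f" "\<And>x. x \<in> U \<Longrightarrow> norm (f x) \<le> W x"
    and "\<And>i x. x \<in> U \<Longrightarrow> has_partial i f (D i x) x"
    and "\<And>i. jet_bound \<mu> U k (\<lambda>x. \<mu> * W x) (D i)"
  shows "jet_bound \<mu> U (Suc k) W f"
proof -
  have "jet_bound \<mu> U k (\<lambda>x. \<mu> * W x) (partial_deriv i f)" for i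
    by (rule jet_bound_cong[OF assms(1) assms(5)[of i]]) (use assms(4) in \<open>auto simp: has_partial_iff\<close>)
  then show ?thesis using assms by (auto simp: has_partial_iff)
qed

lemma jet_bound_weaken:
  assumes "jet_bound \<mu> U k W f" "0 \<le> \<mu>" "j \<le> k" "\<And>x. x \<in> U \<Longrightarrow> W x \<le> V x"
  shows "jet_bound \<mu> U j V f"
  using assms(1,3,4)
proof (induction j arbitrary: k W V f)
  case 0
  then show ?case using jet_boundD[OF 0(1)] by (auto intro: order_trans)
next
  case (Suc j)
  then obtain k' where k': "k = Suc k'" "j \<le> k'" by (cases k) auto
  have "jet_bound \<mu> U j (\<lambda>x. \<mu> * V x) (partial_deriv i f)" for i
    by (rule Suc.IH[OF jet_bound_SucD(2)[OF Suc.prems(1)[unfolded k'(1)]] k'(2)])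
       (use Suc.prems(3) assms(2) in \<open>simp add: mult_left_mono\<close>)
  moreover have "norm (f x) \<le> V x" if "x \<in> U" for x
    using jet_boundD(2)[OF Suc.prems(1) that] Suc.prems(3)[OF that] by simp
  ultimately show ?case using Suc.prems(1) unfolding k'(1) by simp
qed

lemma jet_bound_add:
  assumes "open U" "jet_bound \<mu> U k W f" "jet_bound \<mu> U k V g"
  shows "jet_bound \<mu> U k (\<lambda>x. W x + V x) (\<lambda>x. f x + g x)"
  using assms(2,3)
proof (induction k arbitrary: W V f g)
  case 0
  then show ?case by (auto intro!: continuous_intros norm_triangle_le add_mono)
next
  case (Suc k)
  show ?case
  proof (rule jet_bound_SucI[OF assms(1)])
    show "continuous_on U (\<lambda>x. f x + g x)" using Suc.prems by (auto intro!: continuous_intros)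
    show "norm (f x + g x) \<le> W x + V x" if "x \<in> U" for x
      using Suc.prems that by (auto intro!: norm_triangle_le add_mono)
    show "has_partial i (\<lambda>x. f x + g x) (partial_deriv i f x + partial_deriv i g x) x" if "x \<in> U" for i x
      by (intro has_partial_add jet_bound_SucD(1)[OF Suc.prems(1) that] jet_bound_SucD(1)[OF Suc.prems(2) that])
    show "jet_bound \<mu> U k (\<lambda>x. \<mu> * (W x + V x)) (\<lambda>x. partial_deriv i f x + partial_deriv i g x)" for i
      using Suc.IH[OF jet_bound_SucD(2)[OF Suc.prems(1)] jet_bound_SucD(2)[OF Suc.prems(2)]]
      by (simp add: distrib_left)
  qed
qed

lemma jet_bound_0: "open U \<Longrightarrow> 0 \<le> \<mu> \<Longrightarrow> jet_bound \<mu> U k (\<lambda>_. 0) (\<lambda>_. 0)"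
proof (induction k)
  case (Suc k)
  show ?case
    by (rule jet_bound_SucI[where D = "\<lambda>_ _. 0"]) (use Suc has_partial_const in auto)
qed auto

lemma jet_bound_sum:
  assumes "open U" "0 \<le> \<mu>" "finite A" "\<And>a. a \<in> A \<Longrightarrow> jet_bound \<mu> U k (W a) (f a)"
  shows "jet_bound \<mu> U k (\<lambda>x. \<Sum>a\<in>A. W a x) (\<lambda>x. \<Sum>a\<in>A. f a x)"
  using assms(3,4)
proof (induction A rule: finite_induct)
  case empty
  then show ?case using jet_bound_0[OF assms(1,2)] by simp
next
  case (insert a A)
  then show ?case using jet_bound_add[OF assms(1), of \<mu> k "W a" "f a"] by simp
qed

lemma jet_bound_linear:
  assumes "open U" "bounded_linear L" "\<And>v. norm (L v) \<le> B * norm v" "0 \<le> B" "jet_bound \<mu> U k W f"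
  shows "jet_bound \<mu> U k (\<lambda>x. B * W x) (\<lambda>x. L (f x))"
  using assms(5)
proof (induction k arbitrary: W f)
  case 0
  then show ?case
    by (auto intro!: bounded_linear.continuous_on[OF assms(2)] order_trans[OF assms(3)] mult_left_mono assms(4))
next
  case (Suc k)
  show ?case
  proof (rule jet_bound_SucI[OF assms(1)])
    show "continuous_on U (\<lambda>x. L (f x))"
      by (rule bounded_linear.continuous_on[OF assms(2) jet_boundD(1)[OF Suc.prems]])
    show "norm (L (f x)) \<le> B * W x" if "x \<in> U" for x
      by (rule order_trans[OF assms(3)]) (intro mult_left_mono jet_boundD(2)[OF Suc.prems that] assms(4))
    show "has_partial i (\<lambda>x. L (f x)) (L (partial_deriv i f x)) x" if "x \<in> U" for i x
      by (rule has_partial_linear[OF assms(2) jet_bound_SucD(1)[OF Suc.prems that]])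
    show "jet_bound \<mu> U k (\<lambda>x. \<mu> * (B * W x)) (\<lambda>x. L (partial_deriv i f x))" for i
      using Suc.IH[OF jet_bound_SucD(2)[OF Suc.prems]] by (simp add: mult.left_commute)
  qed
qed

text \<open>Leibniz' rule: each derivative at most doubles the number of terms, all with the same bound.\<close>

lemma jet_bound_scaleR:
  assumes "open U" "0 \<le> \<mu>" "jet_bound \<mu> U k W f" "jet_bound \<mu> U k V g"
  shows "jet_bound \<mu> U k (\<lambda>x. 2 ^ k * (W x * V x)) (\<lambda>x. f x *\<^sub>R g x)"
  using assms(3,4)
proof (induction k arbitrary: W V f g)
  case 0
  have "0 \<le> W x" if "x \<in> U" for x
    using jet_bound_nonneg[OF 0(1) that] .
  with 0 show ?case by (auto intro!: continuous_intros mult_mono)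
next
  case (Suc k)
  have k: "jet_bound \<mu> U k W f" "jet_bound \<mu> U k V g"
    by (rule jet_bound_weaken[OF Suc.prems(1) assms(2)], auto)
       (rule jet_bound_weaken[OF Suc.prems(2) assms(2)], auto)
  have nn: "0 \<le> W x" "0 \<le> V x" if "x \<in> U" for x
    using jet_bound_nonneg Suc.prems that by blast+
  show ?case
  proof (rule jet_bound_SucI[OF assms(1)])
    show "continuous_on U (\<lambda>x. f x *\<^sub>R g x)" using Suc.prems by (auto intro!: continuous_intros)
    show "norm (f x *\<^sub>R g x) \<le> 2 ^ Suc k * (W x * V x)" if "x \<in> U" for x
    proof -
      have "norm (f x *\<^sub>R g x) \<le> 1 * (W x * V x)"
        using jet_boundD(2)[OF k(1) that] jet_boundD(2)[OF k(2) that] nn[OF that]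
        by (auto intro!: mult_mono)
      also have "\<dots> \<le> 2 ^ Suc k * (W x * V x)"
        using nn[OF that] by (intro mult_right_mono one_le_power) auto
      finally show ?thesis .
    qed
    show "has_partial i (\<lambda>x. f x *\<^sub>R g x) (f x *\<^sub>R partial_deriv i g x + partial_deriv i f x *\<^sub>R g x) x" if "x \<in> U" for i x
      by (intro has_partial_scaleR jet_bound_SucD(1)[OF Suc.prems(1) that] jet_bound_SucD(1)[OF Suc.prems(2) that])
    show "jet_bound \<mu> U k (\<lambda>x. \<mu> * (2 ^ Suc k * (W x * V x))) (\<lambda>x. f x *\<^sub>R partial_deriv i g x + partial_deriv i f x *\<^sub>R g x)" for i
      using jet_bound_add[OF assms(1) Suc.IH[OF k(1) jet_bound_SucD(2)[OF Suc.prems(2)]]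
          Suc.IH[OF jet_bound_SucD(2)[OF Suc.prems(1)] k(2)]]
      by (simp add: algebra_simps)
  qed
qed

lemma jet_bound_of_Ck:
  assumes "Ck_on k f U"
    and "\<And>is x. length is \<le> k \<Longrightarrow> x \<in> U \<Longrightarrow> norm (iter_partial is f x) \<le> \<mu> ^ length is * W x"
  shows "jet_bound \<mu> U k W f"
  using assms
proof (induction k arbitrary: f W)
  case 0
  then show ?case using 0(2)[of "[]"] by simp
next
  case (Suc k)
  have "jet_bound \<mu> U k (\<lambda>x. \<mu> * W x) (partial_deriv i f)" for i
  proof (rule Suc.IH)
    show "Ck_on k (partial_deriv i f) U" using Suc.prems(1) by simp
    show "norm (iter_partial is (partial_deriv i f) x) \<le> \<mu> ^ length is * (\<mu> * W x)" if "length is \<le> k" "x \<in> U" for "is" x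
      using Suc.prems(2)[of "i # is" x] that by (simp add: algebra_simps)
  qed
  moreover have "norm (f x) \<le> W x" if "x \<in> U" for x
    using Suc.prems(2)[of "[]" x] that by simp
  ultimately show ?case using Suc.prems(1) by simp
qed

text \<open>Translates hypotheses on multi-indices into jet bounds for the function differentiated along \<open>ks\<close>.
The list is empty for the amplitude and has length two for the phase, whose derivatives are only
controlled from order two on.\<close>

lemma jet_bound_of_multi_deriv:
  fixes f :: "real ^ 'd::finite \<Rightarrow> 'b::real_inner"
  assumes "open U" "Ck_on (length ks + k) f U"
    and "\<And>\<gamma> x. x \<in> U \<Longrightarrow> length ks \<le> mi_order \<gamma> \<Longrightarrow> mi_order \<gamma> \<le> length ks + k \<Longrightarrow>
        norm (multi_deriv \<gamma> f x) \<le> B (mi_order \<gamma> - length ks)"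
    and "\<And>n. n \<le> k \<Longrightarrow> B n \<le> \<mu> ^ n * W"
  shows "jet_bound \<mu> U k (\<lambda>_. W) (iter_partial ks f)"
proof (rule jet_bound_of_Ck)
  show "Ck_on k (iter_partial ks f) U"
    using assms(2) by (induction ks arbitrary: f) auto
  fix "is" :: "'d list" and x assume i: "length is \<le> k" and x: "x \<in> U"
  have "Ck_on (length (ks @ is)) f U"
    by (rule Ck_on_mono[OF assms(2)]) (use i in simp)
  from multi_deriv_list[OF assms(1) this x]
  have "iter_partial is (iter_partial ks f) x = multi_deriv (count_list (ks @ is)) f x"
    by (simp add: iter_partial_append)
  then have "norm (iter_partial is (iter_partial ks f) x) \<le> B (length is)"
    using assms(3)[OF x, of "count_list (ks @ is)"] i by (simp add: mi_order_count_list)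
  also have "\<dots> \<le> \<mu> ^ length is * W" by (rule assms(4)[OF i])
  finally show "norm (iter_partial is (iter_partial ks f) x) \<le> \<mu> ^ length is * W" .
qed

section \<open>Integrals of compactly supported functions and their partial derivatives\<close>

lemma has_partial_difference_quotient:
  assumes "has_partial i f D x"
  shows "((\<lambda>h. (f (x + h *\<^sub>R axis i 1) - f x) /\<^sub>R h) \<longlongrightarrow> D) (at 0)"
proof -
  have "((\<lambda>h. norm (f (x + h *\<^sub>R axis i 1) - f x - h *\<^sub>R D) / norm h) \<longlongrightarrow> 0) (at 0)"
    using assms by (simp add: has_partial_def has_vector_derivative_def has_derivative_iff_norm)
  moreover have "\<forall>\<^sub>F h in at (0::real). norm (f (x + h *\<^sub>R axis i 1) - f x - h *\<^sub>R D) / norm h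
      = norm ((f (x + h *\<^sub>R axis i 1) - f x) /\<^sub>R h - D)"
    unfolding eventually_at_filter
  proof (intro always_eventually allI impI)
    fix h :: real assume "h \<noteq> 0"
    then have "(f (x + h *\<^sub>R axis i 1) - f x) /\<^sub>R h - D = (f (x + h *\<^sub>R axis i 1) - f x - h *\<^sub>R D) /\<^sub>R h"
      by (simp add: scaleR_diff_right)
    then show "norm (f (x + h *\<^sub>R axis i 1) - f x - h *\<^sub>R D) / norm h = norm ((f (x + h *\<^sub>R axis i 1) - f x) /\<^sub>R h - D)"
      by (simp add: divide_inverse mult.commute)
  qed
  ultimately have "((\<lambda>h. norm ((f (x + h *\<^sub>R axis i 1) - f x) /\<^sub>R h - D)) \<longlongrightarrow> 0) (at 0)"
    by (rule Lim_transform_eventually)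
  from LIM_zero_cancel[OF tendsto_norm_zero_cancel[OF this]] show ?thesis .
qed

lemma integrable_compact_support:
  fixes F :: "'a::euclidean_space \<Rightarrow> 'b::{banach, second_countable_topology}"
  assumes "compact K" "continuous_on K F" "\<And>x. x \<notin> K \<Longrightarrow> F x = 0"
  shows "integrable lborel F"
proof -
  have "F = (\<lambda>x. indicator K x *\<^sub>R F x)"
    using assms(3) by (auto simp: indicator_def)
  with borel_integrable_compact[OF assms(1,2)] show ?thesis by simp
qed

lemma integral_translation:
  fixes F :: "'a::euclidean_space \<Rightarrow> 'b::{banach, second_countable_topology}"
  assumes "F \<in> borel_measurable borel"
  shows "(LINT x|lborel. F (x + c)) = (LINT x|lborel. F x)"
proof -
  have "(LINT x|lborel. F x) = (LINT x|distr lborel borel ((+) c). F x)"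
    by (simp only: lborel_distr_plus)
  also have "\<dots> = (LINT x|lborel. F (c + x))"
    by (rule integral_distr) (simp_all add: assms)
  finally show ?thesis by (simp add: add.commute)
qed

text \<open>By translation invariance every difference quotient of \<open>F\<close> in direction \<open>i\<close> has integral zero, and
dominated convergence passes this to the derivative.  The quotients vanish outside a fixed ball and are bounded by the
maximum of the derivative.\<close>

lemma integral_partial_deriv_eq_0:
  fixes F F' :: "real ^ 'd::finite \<Rightarrow> complex"
  assumes F: "\<And>x. has_partial i F (F' x) x" "continuous_on UNIV F" "continuous_on UNIV F'"
    and K: "compact K" "\<And>x. x \<notin> K \<Longrightarrow> F x = 0"
  shows "(LINT x|lborel. F' x) = 0"
proof -
  let ?e = "axis i 1 :: real ^ 'd"
  have F'0: "F' x = 0" if "x \<notin> K" for x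
  proof -
    have "has_partial i (\<lambda>_. 0) (F' x) x"
      by (rule has_partial_cong_open[OF F(1), of "- K"]) (use K that compact_imp_closed in auto)
    with has_partial_const[of i "0::complex" x] show ?thesis by (simp add: has_partial_iff)
  qed
  obtain R where R: "\<And>x. x \<in> K \<Longrightarrow> norm x \<le> R"
    using compact_imp_bounded[OF K(1)] by (auto simp: bounded_iff)
  have "bounded (F' ` K)"
    by (intro compact_imp_bounded compact_continuous_image K continuous_on_subset[OF F(3)]) auto
  then obtain M0 where M0: "\<And>x. x \<in> K \<Longrightarrow> norm (F' x) \<le> M0"
    by (auto simp: bounded_iff)
  define M where "M = max M0 0"
  have M: "norm (F' x) \<le> M" for x
    using M0[of x] F'0[of x] by (cases "x \<in> K") (auto simp: M_def)
  \<comment> \<open>All translates by at most one unit of the support stay in this ball.\<close>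
  define B where "B = cball (0 :: real ^ 'd) (R + 1)"
  define h where "h n = inverse (real (Suc n))" for n
  have h: "0 < h n" "h n \<le> 1" for n by (auto simp: h_def inverse_le_1_iff)
  define s where "s n x = (F (x + h n *\<^sub>R ?e) - F x) /\<^sub>R h n" for n x
  have intF: "integrable lborel F"
    by (rule integrable_compact_support[OF K(1) continuous_on_subset[OF F(2)]]) (use K in auto)
  have measF: "F \<in> borel_measurable borel" using borel_measurable_continuous_onI[OF F(2)] by simp
  have intF': "integrable lborel (\<lambda>x. F (x + c))" for c
  proof (rule integrable_compact_support)
    show "compact ((\<lambda>x. x - c) ` K)" by (intro compact_continuous_image K continuous_intros)
    show "continuous_on ((\<lambda>x. x - c) ` K) (\<lambda>x. F (x + c))"
      by (intro continuous_on_compose2[OF F(2)] continuous_intros) auto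
    fix x assume "x \<notin> (\<lambda>x. x - c) ` K"
    then have "x + c \<notin> K" by (metis add_diff_cancel image_eqI)
    then show "F (x + c) = 0" by (rule K)
  qed
  have s0: "(LINT x|lborel. s n x) = 0" for n
    unfolding s_def using intF intF' by (simp add: integral_translation[OF measF])
  have lim: "(\<lambda>n. s n x) \<longlonglongrightarrow> F' x" for x
  proof -
    have "filterlim h (at 0) sequentially"
      unfolding filterlim_at using h(1) LIMSEQ_inverse_real_of_nat
      by (auto simp: h_def[abs_def] intro!: always_eventually)
    from filterlim_compose[OF has_partial_difference_quotient[OF F(1)] this]
    show ?thesis by (simp add: s_def)
  qed
  have bound: "norm (s n x) \<le> M * indicator B x" for n x
  proof (cases "x \<in> B")
    case True
    have "\<exists>t\<in>{0<..<h n}. norm (F (x + h n *\<^sub>R ?e) - F (x + 0 *\<^sub>R ?e)) \<le> norm ((h n - 0) *\<^sub>R F' (x + t *\<^sub>R ?e))"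
    proof (rule mvt_general[where f = "\<lambda>t. F (x + t *\<^sub>R ?e)"])
      show "continuous_on {0..h n} (\<lambda>t. F (x + t *\<^sub>R ?e))"
        by (intro continuous_on_compose2[OF F(2)] continuous_intros) auto
      show "((\<lambda>t. F (x + t *\<^sub>R ?e)) has_derivative (\<lambda>v. v *\<^sub>R F' (x + t *\<^sub>R ?e))) (at t)" for t
        using has_partial_along_line[OF F(1)] by (simp add: has_vector_derivative_def)
    qed (rule h)
    then obtain t where "norm (F (x + h n *\<^sub>R ?e) - F x) \<le> h n * norm (F' (x + t *\<^sub>R ?e))"
      using h[of n] by auto
    also have "\<dots> \<le> h n * M" using M h[of n] by (simp add: mult_left_mono)
    finally have "norm (F (x + h n *\<^sub>R ?e) - F x) / h n \<le> M"
      using h(1)[of n] by (simp add: pos_divide_le_eq mult.commute)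
    moreover have "norm (s n x) = norm (F (x + h n *\<^sub>R ?e) - F x) / h n"
      using h(1)[of n] by (simp add: s_def divide_inverse mult.commute)
    ultimately show ?thesis using True by simp
  next
    case False
    have "norm x \<le> norm (x + h n *\<^sub>R ?e) + norm (h n *\<^sub>R ?e)"
      using norm_triangle_ineq4[of "x + h n *\<^sub>R ?e" "h n *\<^sub>R ?e"] by simp
    then have "norm (x + h n *\<^sub>R ?e) > R" using h[of n] False by (auto simp: B_def)
    moreover have "norm x > R" using False by (auto simp: B_def)
    moreover have "F z = 0" if "norm z > R" for z
      using K(2)[of z] R[of z] that by auto
    ultimately have "F (x + h n *\<^sub>R ?e) = 0" "F x = 0" by blast+
    then show ?thesis using False by (simp add: s_def)
  qed
  have "(\<lambda>n. LINT x|lborel. s n x) \<longlonglongrightarrow> (LINT x|lborel. F' x)"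
  proof (rule integral_dominated_convergence)
    show "F' \<in> borel_measurable lborel" using borel_measurable_continuous_onI[OF F(3)] by simp
    show "s n \<in> borel_measurable lborel" for n
      using intF intF'[of "h n *\<^sub>R ?e"] unfolding s_def by (auto dest!: borel_measurable_integrable)
    have "integrable lborel (indicator B :: _ \<Rightarrow> real)"
      unfolding B_def by (intro integrable_real_indicator) (use emeasure_bounded_finite[of "cball (0 :: real ^ 'd) (R + 1)"] in auto)
    then show "integrable lborel (\<lambda>x. M * indicator B x)" by simp
    show "AE x in lborel. norm (s n x) \<le> M * indicator B x" for n using bound by simp
    show "AE x in lborel. (\<lambda>n. s n x) \<longlonglongrightarrow> F' x" using lim by simp
  qed
  then show ?thesis by (simp add: s0 LIMSEQ_const_iff)
qed

lemma continuous_on_extend_by_zero: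
  fixes f :: "'a::topological_space \<Rightarrow> 'b::real_normed_vector"
  assumes "open U" "closed K" "K \<subseteq> U" "continuous_on U f" "\<And>x. x \<notin> K \<Longrightarrow> f x = 0"
  shows "continuous_on UNIV f"
proof -
  have "continuous_on (- K) f \<longleftrightarrow> continuous_on (- K) (\<lambda>_. 0 :: 'b)"
    by (rule continuous_on_cong) (use assms(5) in auto)
  then have "continuous_on (- K) f" by simp
  then have "continuous_on (U \<union> - K) f"
    by (intro continuous_on_open_Un) (use assms in auto)
  moreover have "U \<union> - K = UNIV" using assms(3) by auto
  ultimately show ?thesis by simp
qed

lemma has_partial_off_support:
  assumes "closed K" "\<And>x. x \<notin> K \<Longrightarrow> f x = 0" "x \<notin> K"
  shows "has_partial i f 0 x"
  by (rule has_partial_cong_open[OF has_partial_const[of i 0], of "- K"]) (use assms in auto)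

lemma norm_integral_le_on_compact:
  fixes F :: "real ^ 'd::finite \<Rightarrow> complex"
  assumes K: "compact K" "\<And>x. x \<notin> K \<Longrightarrow> F x = 0"
    and g: "continuous_on K g" "\<And>x. x \<in> K \<Longrightarrow> norm (F x) \<le> g x"
  shows "norm (LINT x|lborel. F x) \<le> (LINT x|lborel. indicator K x * g x)"
proof (cases "integrable lborel F")
  case True
  have "norm (LINT x|lborel. F x) \<le> (LINT x|lborel. norm (F x))"
    by (rule integral_norm_bound)
  also have "\<dots> \<le> (LINT x|lborel. indicator K x * g x)"
  proof (rule integral_mono)
    show "integrable lborel (\<lambda>x. indicator K x * g x)"
      using borel_integrable_compact[OF K(1) g(1)] by simp
    show "norm (F x) \<le> indicator K x * g x" for x
      using K(2) g(2) by (cases "x \<in> K") auto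
  qed (use True in auto)
  finally show ?thesis .
next
  case False
  have "0 \<le> (LINT x|lborel. indicator K x * g x)"
    by (rule integral_nonneg_AE) (use g(2) in \<open>auto simp: indicator_def intro: order_trans[OF norm_ge_zero]\<close>)
  with False show ?thesis by (simp add: not_integrable_integral_eq)
qed

section \<open>A lower bound for the volume of an injective differentiable image\<close>

text \<open>The change of variables theorems assume that the index type of the coordinates is well-ordered.
A copy of the index type, ordered through an enumeration, gives a volume-preserving relabelling of
coordinates that carries them over to arbitrary finite index types.\<close>

typedef 'a ordered_copy = "UNIV :: 'a set" by simp

instance ordered_copy :: (finite) finite
proof
  have "(UNIV :: 'a ordered_copy set) = range Abs_ordered_copy"
    by (metis Abs_ordered_copy_cases UNIV_eq_I rangeI)
  then show "finite (UNIV :: 'a ordered_copy set)" by (metis finite finite_imageI)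
qed

lemma bij_Rep_ordered_copy: "bij Rep_ordered_copy"
  by (rule bij_betw_byWitness[of _ Abs_ordered_copy]) (auto simp: Rep_ordered_copy_inverse Abs_ordered_copy_inverse)

lemma Abs_ordered_copy_eq_iff: "Abs_ordered_copy i = j \<longleftrightarrow> i = Rep_ordered_copy j"
  by (auto simp: Rep_ordered_copy_inverse Abs_ordered_copy_inverse)

lemma all_ordered_copy_iff: "(\<forall>i. Q i (Rep_ordered_copy i)) \<longleftrightarrow> (\<forall>i. Q (Abs_ordered_copy i) i)"
proof (intro iffI allI)
  show "Q (Abs_ordered_copy i) i" if "\<forall>i. Q i (Rep_ordered_copy i)" for i
    using that[rule_format, of "Abs_ordered_copy i"] by (simp add: Abs_ordered_copy_inverse)
  show "Q i (Rep_ordered_copy i)" if "\<forall>i. Q (Abs_ordered_copy i) i" for i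
    using that[rule_format, of "Rep_ordered_copy i"] by (simp add: Rep_ordered_copy_inverse)
qed

instantiation ordered_copy :: (finite) wellorder
begin

definition "x \<le> (y :: 'a ordered_copy) \<longleftrightarrow> to_nat_on UNIV x \<le> to_nat_on UNIV y"

definition "x < (y :: 'a ordered_copy) \<longleftrightarrow> to_nat_on UNIV x < to_nat_on UNIV y"

instance
proof
  have inj: "inj (to_nat_on (UNIV :: 'a ordered_copy set))"
    by (intro inj_on_to_nat_on countable_finite finite)
  show "x = y" if "x \<le> y" "y \<le> x" for x y :: "'a ordered_copy"
    using that inj by (auto simp: less_eq_ordered_copy_def dest: injD)
  show "P a" if "\<And>x. (\<And>y. y < x \<Longrightarrow> P y) \<Longrightarrow> P x" for P and a :: "'a ordered_copy"
  proof (induction a rule: measure_induct_rule[where f = "to_nat_on UNIV"])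
    case (less x)
    show ?case
      by (rule that, rule less.IH) (simp add: less_ordered_copy_def)
  qed
qed (auto simp: less_eq_ordered_copy_def less_ordered_copy_def)

end

definition to_ordered :: "real ^ 'd \<Rightarrow> real ^ 'd ordered_copy" where
  "to_ordered x = (\<chi> i. x $ Rep_ordered_copy i)"

definition of_ordered :: "real ^ 'd ordered_copy \<Rightarrow> real ^ 'd" where
  "of_ordered x = (\<chi> i. x $ Abs_ordered_copy i)"

lemma to_of_ordered [simp]: "to_ordered (of_ordered x) = x" "of_ordered (to_ordered y) = y"
  by (simp_all add: to_ordered_def of_ordered_def vec_eq_iff Rep_ordered_copy_inverse Abs_ordered_copy_inverse)

lemma linear_ordered: "linear (to_ordered :: real ^ 'd::finite \<Rightarrow> _)" "linear (of_ordered :: _ \<Rightarrow> real ^ 'd::finite)"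
  by (auto simp: to_ordered_def of_ordered_def vec_eq_iff intro!: linearI)

lemma bounded_linear_ordered: "bounded_linear (to_ordered :: real ^ 'd::finite \<Rightarrow> _)" "bounded_linear (of_ordered :: _ \<Rightarrow> real ^ 'd::finite)"
  by (simp_all add: linear_ordered linear_conv_bounded_linear[symmetric])

lemma prod_Basis_cart:
  fixes f :: "real ^ 'n::finite \<Rightarrow> 'b::comm_monoid_mult"
  shows "(\<Prod>b\<in>Basis. f b) = (\<Prod>i\<in>(UNIV :: 'n::finite set). f (axis i (1::real)))"
proof -
  have B: "(Basis :: (real ^ 'n::finite) set) = range (\<lambda>i. axis i 1)"
    by (auto simp: Basis_vec_def)
  have inj: "inj (\<lambda>i::'n. axis i (1::real))"
    by (simp add: inj_on_def axis_eq_axis)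
  show ?thesis
    unfolding B by (subst prod.reindex[OF inj]) simp
qed

lemma to_ordered_measurable [measurable]: "(to_ordered :: real ^ 'd::finite \<Rightarrow> _) \<in> borel_measurable borel"
  by (intro borel_measurable_continuous_onI linear_continuous_on bounded_linear_ordered)

text \<open>Relabelling coordinates maps boxes to boxes with the same side lengths.\<close>

lemma lborel_distr_to_ordered: "(lborel :: (real ^ 'd::finite ordered_copy) measure) = distr lborel borel to_ordered"
proof (rule lborel_eqI)
  fix l u :: "real ^ 'd ordered_copy"
  assume le: "\<And>b. b \<in> Basis \<Longrightarrow> l \<bullet> b \<le> u \<bullet> b"
  have le': "l $ i \<le> u $ i" for i
    using le[of "axis i 1"] by (simp add: axis_in_Basis_iff inner_axis)
  have pre: "to_ordered -` box l u = box (of_ordered l) (of_ordered u)"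
  proof -
    have "(\<forall>i. l $ i < x $ Rep_ordered_copy i \<and> x $ Rep_ordered_copy i < u $ i) \<longleftrightarrow> (\<forall>i. l $ Abs_ordered_copy i < x $ i \<and> x $ i < u $ Abs_ordered_copy i)" for x :: "real ^ 'd"
      by (rule all_ordered_copy_iff)
    then show ?thesis
      by (simp add: set_eq_iff mem_box_cart to_ordered_def of_ordered_def)
  qed
  have "emeasure (distr lborel borel to_ordered) (box l u) = emeasure lborel (box (of_ordered l) (of_ordered u))"
    by (subst emeasure_distr) (auto simp: pre)
  also have "\<dots> = ennreal (\<Prod>b\<in>Basis. (of_ordered u - of_ordered l) \<bullet> b)"
    by (rule emeasure_lborel_box) (auto simp: Basis_vec_def inner_axis of_ordered_def le')
  also have "(\<Prod>b\<in>Basis. (of_ordered u - of_ordered l) \<bullet> b) = (\<Prod>i\<in>UNIV. (\<lambda>i. u $ i - l $ i) (Abs_ordered_copy i))"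
    by (simp add: prod_Basis_cart inner_axis of_ordered_def)
  also have "\<dots> = (\<Prod>i\<in>UNIV. u $ i - l $ i)"
    by (rule prod.reindex_bij_witness[of _ Rep_ordered_copy Abs_ordered_copy]) (auto simp: Rep_ordered_copy_inverse Abs_ordered_copy_inverse)
  also have "\<dots> = (\<Prod>b\<in>Basis. (u - l) \<bullet> b)"
    by (simp add: prod_Basis_cart inner_axis)
  finally show "emeasure (distr lborel borel to_ordered) (box l u) = ennreal (\<Prod>b\<in>Basis. (u - l) \<bullet> b)" .
qed simp

lemma emeasure_to_ordered_image:
  fixes A :: "(real ^ 'd::finite) set"
  assumes "to_ordered ` A \<in> sets borel"
  shows "emeasure lborel (to_ordered ` A) = emeasure lborel A"
proof -
  have "to_ordered -` to_ordered ` A = A" by (metis (no_types) inj_vimage_image_eq injI to_of_ordered(2))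
  then show ?thesis
    by (subst lborel_distr_to_ordered, subst emeasure_distr) (use assms in auto)
qed

text \<open>In the Leibniz formula, conjugation by the bijection of indices permutes the summands and preserves
the sign of the permutations.\<close>

lemma det_ordered_copy:
  fixes A :: "real ^ 'd::finite ^ 'd"
  shows "det (\<chi> i j. A $ Rep_ordered_copy i $ Rep_ordered_copy j) = det A"
proof -
  let ?m = "map_permutation UNIV (Abs_ordered_copy :: 'd \<Rightarrow> _)"
  have bij: "bij (Abs_ordered_copy :: 'd \<Rightarrow> _)"
    by (rule bij_betw_byWitness[of _ Rep_ordered_copy]) (auto simp: Rep_ordered_copy_inverse Abs_ordered_copy_inverse)
  have inj: "inj (Abs_ordered_copy :: 'd \<Rightarrow> _)" using bij by (rule bij_is_inj)
  have app: "?m p (Abs_ordered_copy i) = Abs_ordered_copy (p i)" for p i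
    by (rule map_permutation_apply[OF inj]) auto
  have app': "?m p i = Abs_ordered_copy (p (Rep_ordered_copy i))" for p i
    using app[of p "Rep_ordered_copy i"] by (simp add: Rep_ordered_copy_inverse)
  have "det A = (\<Sum>p\<in>{p. p permutes UNIV}. of_int (sign p) * (\<Prod>i\<in>UNIV. A $ i $ p i))"
    by (simp add: det_def)
  also have "\<dots> = (\<Sum>p\<in>{p. p permutes (UNIV :: 'd ordered_copy set)}. of_int (sign p) * (\<Prod>i\<in>UNIV. A $ Rep_ordered_copy i $ Rep_ordered_copy (p i)))"
  proof (rule sum.reindex_bij_witness[of _ "map_permutation UNIV Rep_ordered_copy" ?m])
    fix p :: "'d \<Rightarrow> 'd" assume p: "p \<in> {p. p permutes UNIV}"
    show "map_permutation UNIV Rep_ordered_copy (?m p) = p"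
      by (rule map_permutation_compose_inv[OF bij]) (use p in \<open>auto simp: Abs_ordered_copy_inverse\<close>)
    show "?m p \<in> {p. p permutes UNIV}"
      using p map_permutation_permutes[OF bij] by blast
    have "sign (?m p) = sign p"
      by (rule sign_map_permutation[OF inj]) (use p in auto)
    moreover have "(\<Prod>i\<in>UNIV. A $ Rep_ordered_copy i $ Rep_ordered_copy (?m p i)) = (\<Prod>i\<in>UNIV. A $ i $ p i)"
      by (rule prod.reindex_bij_witness[of _ Abs_ordered_copy Rep_ordered_copy])
         (auto simp: Rep_ordered_copy_inverse Abs_ordered_copy_inverse app')
    ultimately show "of_int (sign (?m p)) * (\<Prod>i\<in>UNIV. A $ Rep_ordered_copy i $ Rep_ordered_copy (?m p i)) = of_int (sign p) * (\<Prod>i\<in>UNIV. A $ i $ p i)"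
      by simp
  next
    fix q :: "'d ordered_copy \<Rightarrow> 'd ordered_copy" assume q: "q \<in> {p. p permutes UNIV}"
    show "?m (map_permutation UNIV Rep_ordered_copy q) = q"
      by (rule map_permutation_compose_inv[OF bij_Rep_ordered_copy]) (use q in \<open>auto simp: Rep_ordered_copy_inverse\<close>)
    show "map_permutation UNIV Rep_ordered_copy q \<in> {p. p permutes UNIV}"
      using q map_permutation_permutes[OF bij_Rep_ordered_copy] by blast
  qed
  finally show ?thesis by (simp add: det_def)
qed

lemma measure_le_image_wellorder:
  fixes g :: "real ^ 'n::{finite,wellorder} \<Rightarrow> real ^ 'n::_"
  assumes S: "S \<in> sets borel" "bounded S"
    and der: "\<And>x. x \<in> S \<Longrightarrow> (g has_derivative g' x) (at x)"
    and inj: "inj_on g S"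
    and im: "g ` S \<subseteq> T" "T \<in> sets borel" "bounded T"
    and L: "L > 0" "\<And>x. x \<in> S \<Longrightarrow> L \<le> \<bar>det (matrix (g' x))\<bar>"
  shows "L * measure lborel S \<le> measure lborel T"
proof -
  have SL: "S \<in> lmeasurable" "T \<in> lmeasurable"
    using S im by (auto intro!: bounded_set_imp_lmeasurable)
  have derS: "(g has_derivative g' x) (at x within S)" if "x \<in> S" for x
    using der[OF that] by (rule has_derivative_at_withinI)
  have "g ` S \<in> sets lebesgue"
    by (rule differentiable_image_in_sets_lebesgue)
       (use SL derS in \<open>auto simp: differentiable_on_def differentiable_def fmeasurableD\<close>)
  then have gS: "g ` S \<in> lmeasurable"
    by (meson bounded_set_imp_lmeasurable bounded_subset im)
  define m where "m = measure lebesgue (g ` S)"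
  have dint: "((\<lambda>x. \<bar>det (matrix (g' x))\<bar>) has_integral m) S"
    using has_measure_differentiable_image[OF fmeasurableD[OF SL(1)] derS inj, of m] gS m_def by simp
  have Lint: "((\<lambda>x. L) has_integral (L * measure lebesgue S)) S"
  proof -
    have "((\<lambda>x. if x \<in> S then L else 0) has_integral (L * measure lebesgue S)) UNIV"
      using has_integral_mult_right[OF lmeasurable_iff_has_integral[THEN iffD1, OF SL(1)], of L]
      by (rule has_integral_eq[rotated]) simp
    then show ?thesis by (simp only: has_integral_restrict_UNIV)
  qed
  have "L * measure lebesgue S \<le> m"
    by (rule has_integral_le[OF Lint dint]) (use L in auto)
  also have "m \<le> measure lebesgue T"
    unfolding m_def by (rule measure_mono_fmeasurable) (use gS SL im in auto)
  finally show ?thesis using S im by (simp add: measure_completion)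
qed

lemma measure_le_image:
  fixes g :: "real ^ 'd::finite \<Rightarrow> real ^ 'd"
  assumes S: "open S" "bounded S"
    and der: "\<And>x. x \<in> S \<Longrightarrow> (g has_derivative g' x) (at x)"
    and inj: "inj_on g S"
    and im: "g ` S \<subseteq> T" "open T" "bounded T"
    and L: "L > 0" "\<And>x. x \<in> S \<Longrightarrow> L \<le> \<bar>det (matrix (g' x))\<bar>"
  shows "L * measure lborel S \<le> measure lborel T"
proof -
  let ?g = "\<lambda>y. to_ordered (g (of_ordered y))" and ?g' = "\<lambda>y v. to_ordered (g' (of_ordered y) (of_ordered v))"
  have eq: "to_ordered ` X = of_ordered -` X" for X :: "(real ^ 'd) set"
  proof (intro set_eqI iffI)
    show "y \<in> to_ordered ` X" if "y \<in> of_ordered -` X" for y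
      using that by (intro image_eqI[of _ _ "of_ordered y"]) auto
  qed auto
  have opn: "open (to_ordered ` X)" if "open X" for X :: "(real ^ 'd) set"
    unfolding eq by (intro open_vimage that linear_continuous_on bounded_linear_ordered)
  have meas: "measure lborel (to_ordered ` X) = measure lborel X" if "open X" for X :: "(real ^ 'd) set"
    using emeasure_to_ordered_image[of X] opn[OF that] by (simp add: measure_def)
  have "L * measure lborel (to_ordered ` S) \<le> measure lborel (to_ordered ` T)"
  proof (rule measure_le_image_wellorder[where g = ?g and g' = ?g'])
    show "bounded (to_ordered ` S)" "bounded (to_ordered ` T)"
      by (intro bounded_linear_image S im bounded_linear_ordered)+
    show "to_ordered ` S \<in> sets borel" "to_ordered ` T \<in> sets borel"
      using opn S im by auto
    show "?g ` to_ordered ` S \<subseteq> to_ordered ` T" using im by auto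
    show "inj_on ?g (to_ordered ` S)"
    proof (rule inj_onI)
      fix y z assume yz: "y \<in> to_ordered ` S" "z \<in> to_ordered ` S" "?g y = ?g z"
      then have "g (of_ordered y) = g (of_ordered z)" by (metis to_of_ordered(2))
      then have "of_ordered y = of_ordered z" using inj yz by (auto dest: inj_onD)
      then show "y = z" by (metis to_of_ordered(1))
    qed
    show "L > 0" by fact
    fix y assume "y \<in> to_ordered ` S"
    then have y: "of_ordered y \<in> S" by auto
    have a: "(of_ordered has_derivative of_ordered) (at y)" for y :: "real ^ 'd ordered_copy"
      by (rule bounded_linear_imp_has_derivative[OF bounded_linear_ordered(2)])
    have b: "(to_ordered has_derivative to_ordered) (at y)" for y :: "real ^ 'd"
      by (rule bounded_linear_imp_has_derivative[OF bounded_linear_ordered(1)])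
    show "(?g has_derivative ?g' y) (at y)"
      by (rule has_derivative_compose[OF has_derivative_compose[OF a der[OF y]] b])
    have [simp]: "of_ordered (axis j (1::real)) = axis (Rep_ordered_copy j) 1" for j :: "'d ordered_copy"
      by (simp add: of_ordered_def axis_def vec_eq_iff Abs_ordered_copy_eq_iff)
    have "matrix (?g' y) = (\<chi> i j. matrix (g' (of_ordered y)) $ Rep_ordered_copy i $ Rep_ordered_copy j)"
      by (simp add: matrix_def vec_eq_iff to_ordered_def)
    then show "L \<le> \<bar>det (matrix (?g' y))\<bar>"
      using L(2)[OF y] by (simp add: det_ordered_copy)
  qed
  then show ?thesis using meas S im by simp
qed

lemma measure_ball_cart:
  fixes c :: "real ^ 'd::finite"
  assumes "0 \<le> R"
  shows "measure lborel (ball c R) = unit_ball_vol (real CARD('d)) * R ^ CARD('d)"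
  using content_ball[OF assms, of c] by simp

lemma sum_axis_mult: "(\<Sum>k\<in>UNIV. axis j (1::real) $ k * g k) = g (j :: 'd::finite)"
proof -
  have "(\<Sum>k\<in>UNIV. axis j (1::real) $ k * g k) = (\<Sum>k\<in>UNIV. if k = j then g k else 0)"
    by (rule sum.cong) (auto simp: axis_def)
  then show ?thesis by simp
qed

section \<open>The rescaled gradient and its weight\<close>

text \<open>The recursion is dictated by lemma \<open>jet_h_b\<close>: the last two summands bound one derivative of the
field \<open>b\<close> through Leibniz' rule, for \<open>n\<close> coordinates.\<close>

primrec phase_const :: "real \<Rightarrow> nat \<Rightarrow> real" where
  "phase_const n 0 = 1"
| "phase_const n (Suc k) = phase_const n k + 2 ^ k * phase_const n k + n * (2 ^ k * (2 ^ k * phase_const n k ^ 2 * 2))"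

lemma phase_const_ge_1: "0 \<le> n \<Longrightarrow> 1 \<le> phase_const n k"
proof (induction k)
  case (Suc k)
  then have "1 \<le> phase_const n k" by simp
  moreover from this Suc.prems
  have "0 \<le> 2 ^ k * phase_const n k" "0 \<le> n * (2 ^ k * (2 ^ k * phase_const n k ^ 2 * 2))" by simp_all
  ultimately show ?case unfolding phase_const.simps by linarith
qed simp

lemma has_partial_exp_phase:
  assumes "has_partial i \<Phi> D x"
  shows "has_partial i (\<lambda>y. exp (\<i> * complex_of_real (c * \<Phi> y))) (exp (\<i> * complex_of_real (c * \<Phi> x)) * (\<i> * complex_of_real (c * D))) x"
proof -
  have "has_partial i (\<lambda>y. \<i> * complex_of_real (c * \<Phi> y)) (\<i> * complex_of_real (c * D)) x"
    by (rule has_partial_linear[OF _ assms])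
       (intro bounded_linear_const_mult bounded_linear_of_real[THEN bounded_linear_compose] bounded_linear_mult_right)
  from field_vector_diff_chain_at[OF this[unfolded has_partial_def] DERIV_exp]
  show ?thesis by (simp add: has_partial_def o_def mult.commute)
qed

text \<open>The parameters stand for \<open>G = \<nabla>\<Phi> / r\<close> and \<open>\<mu> = lam * r\<close>, while \<open>K\<close> contains the support of all
amplitudes.  Bounds are imposed on the derivatives of \<open>G\<close> alone, because the size of \<open>G\<close> itself is what
the weight measures.\<close>

locale scaled_phase =
  fixes \<Phi> :: "real ^ 'd::finite \<Rightarrow> real" and G :: "'d \<Rightarrow> real ^ 'd \<Rightarrow> real"
    and r \<mu> :: real and U K :: "(real ^ 'd) set" and c :: "nat \<Rightarrow> real"
  assumes open_U: "open U" and compact_K: "compact K" and K_U: "K \<subseteq> U"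
    and r_pos: "0 < r" and mu_pos: "0 < \<mu>"
    and cont_Phi: "continuous_on U \<Phi>"
    and has_partial_Phi: "\<And>i x. x \<in> U \<Longrightarrow> has_partial i \<Phi> (r * G i x) x"
    and cont_G: "\<And>i. continuous_on U (G i)"
    and diff_G: "\<And>i k x. x \<in> U \<Longrightarrow> has_partial k (G i) (partial_deriv k (G i) x) x"
    and jet_G: "\<And>i k. jet_bound \<mu> U (CARD('d) - 1) (\<lambda>_. \<mu>) (partial_deriv k (G i))"
    and c_def: "c = phase_const (real CARD('d))"
begin

definition h :: "real ^ 'd \<Rightarrow> real" where "h x = inverse (1 + (\<Sum>i\<in>UNIV. (G i x)\<^sup>2))"
definition w :: "real ^ 'd \<Rightarrow> real" where "w x = sqrt (h x)"
definition b :: "'d \<Rightarrow> real ^ 'd \<Rightarrow> real" where "b i x = h x * G i x"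

lemma G2_nonneg: "0 \<le> (\<Sum>i\<in>UNIV. (G i x)\<^sup>2)"
  by (intro sum_nonneg) simp

lemma h_bounds: "0 < h x" "h x \<le> 1"
  using G2_nonneg[of x] by (simp_all add: h_def inverse_le_1_iff add_pos_nonneg)

lemma w_bounds: "0 < w x" "w x \<le> 1" "w x * w x = h x" "w x ^ 2 = h x" "h x \<le> w x"
proof -
  show 1: "0 < w x" "w x \<le> 1" "w x * w x = h x"
    using h_bounds[of x] by (simp_all add: w_def)
  show "w x ^ 2 = h x" using 1(3) by (simp add: power2_eq_square)
  show "h x \<le> w x" using 1 mult_left_le[of "w x" "w x"] by simp
qed

lemma b_bound: "\<bar>b i x\<bar> \<le> w x"
proof -
  have "(G i x)\<^sup>2 \<le> (\<Sum>i\<in>UNIV. (G i x)\<^sup>2)" by (rule member_le_sum) auto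
  then have "h x * (G i x)\<^sup>2 \<le> h x * (1 + (\<Sum>i\<in>UNIV. (G i x)\<^sup>2))"
    using h_bounds[of x] by (intro mult_left_mono) auto
  also have "\<dots> = 1" using G2_nonneg[of x] by (simp add: h_def)
  finally have "(h x * (G i x)\<^sup>2) * h x \<le> 1 * h x"
    using h_bounds[of x] by (intro mult_right_mono) auto
  then have "(b i x)\<^sup>2 \<le> h x"
    by (simp add: b_def power2_eq_square algebra_simps)
  then have "sqrt ((b i x)\<^sup>2) \<le> sqrt (h x)" by (rule real_sqrt_le_mono)
  then show ?thesis by (simp add: w_def)
qed

lemma sum_G_b: "(\<Sum>i\<in>UNIV. G i x * b i x) = 1 - h x"
proof -
  have "(\<Sum>i\<in>UNIV. G i x * b i x) = h x * (\<Sum>i\<in>UNIV. (G i x)\<^sup>2)"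
    by (simp add: b_def sum_distrib_left power2_eq_square algebra_simps)
  also have "\<dots> = h x * (1 + (\<Sum>i\<in>UNIV. (G i x)\<^sup>2)) - h x" by (simp add: algebra_simps)
  also have "h x * (1 + (\<Sum>i\<in>UNIV. (G i x)\<^sup>2)) = 1" using G2_nonneg[of x] by (simp add: h_def)
  finally show ?thesis .
qed

lemma cont_h: "continuous_on U h"
proof -
  have "1 + (\<Sum>i\<in>UNIV. (G i x)\<^sup>2) \<noteq> 0" for x using G2_nonneg[of x] by linarith
  then show ?thesis unfolding h_def[abs_def] by (intro continuous_intros cont_G) auto
qed

lemma cont_b: "continuous_on U (b i)"
  unfolding b_def[abs_def] by (intro continuous_intros cont_G cont_h)

lemma cont_w: "continuous_on U w"
  unfolding w_def[abs_def] by (intro continuous_intros cont_h)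

lemma has_partial_h:
  assumes "x \<in> U"
  shows "has_partial k h (\<Sum>i\<in>UNIV. (h x * b i x) * (- 2 * partial_deriv k (G i) x)) x"
proof -
  let ?D = "\<lambda>i. partial_deriv k (G i) x"
  have "has_partial k (\<lambda>y. 1 + (\<Sum>i\<in>UNIV. G i y * G i y)) (0 + (\<Sum>i\<in>UNIV. G i x * ?D i + ?D i * G i x)) x"
    by (intro has_partial_add has_partial_const has_partial_sum has_partial_mult diff_G assms)
  moreover have "1 + (\<Sum>i\<in>UNIV. G i x * G i x) \<noteq> 0"
    using G2_nonneg[of x] by (simp add: power2_eq_square)
  ultimately have "has_partial k h (- (h x * (\<Sum>i\<in>UNIV. G i x * ?D i + ?D i * G i x) * h x)) x"
    using has_partial_inverse[of k "\<lambda>y. 1 + (\<Sum>i\<in>UNIV. G i y * G i y)"]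
    by (simp add: h_def[abs_def] power2_eq_square)
  also have "- (h x * (\<Sum>i\<in>UNIV. G i x * ?D i + ?D i * G i x) * h x) = (\<Sum>i\<in>UNIV. (h x * b i x) * (- 2 * ?D i))"
    by (simp add: b_def sum_distrib_left sum_distrib_right sum_negf[symmetric] algebra_simps)
  finally show ?thesis .
qed

text \<open>The factor \<open>G i\<close> that arises from differentiating \<open>h\<close> is absorbed into \<open>b i\<close>.  Thus the derivative is
a sum of products of \<open>h\<close>, of \<open>b\<close> and of derivatives of \<open>G\<close>, all of which obey jet bounds.\<close>

lemma has_partial_b_formula:
  assumes "x \<in> U"
  shows "has_partial k (b i) (h x * partial_deriv k (G i) x + (\<Sum>l\<in>UNIV. (b l x * b i x) * (- 2 * partial_deriv k (G l) x))) x"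
proof -
  have "has_partial k (b i) (h x * partial_deriv k (G i) x + (\<Sum>l\<in>UNIV. (h x * b l x) * (- 2 * partial_deriv k (G l) x)) * G i x) x"
  proof -
    have "b i = (\<lambda>y. h y * G i y)" by (simp add: b_def fun_eq_iff)
    then show ?thesis by (simp only:) (intro has_partial_mult has_partial_h diff_G assms)
  qed
  also have "(\<Sum>l\<in>UNIV. (h x * b l x) * (- 2 * partial_deriv k (G l) x)) * G i x
      = (\<Sum>l\<in>UNIV. (b l x * b i x) * (- 2 * partial_deriv k (G l) x))"
    by (simp add: b_def[of i] sum_distrib_left sum_distrib_right algebra_simps)
  finally show ?thesis .
qed

lemma mu_nonneg: "0 \<le> \<mu>" using mu_pos by simp

text \<open>One summand pattern covers the derivatives of both \<open>h\<close> (with \<open>f = h\<close>) and \<open>b\<close> (with \<open>f\<close> a component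
of \<open>b\<close>).  The bound \<open>h = w^2\<close> on the right is the source of the extra factor \<open>w\<close> that each
differentiation of \<open>b\<close> gains.\<close>

lemma jet_bound_triple_product:
  assumes j: "j \<le> CARD('d) - 1"
    and f: "jet_bound \<mu> U j (\<lambda>x. c j * V x) f"
    and g: "\<And>l. jet_bound \<mu> U j (\<lambda>x. c j * w x) (g l)"
    and V: "\<And>x. V x \<le> w x" "\<And>x. 0 \<le> V x"
  shows "jet_bound \<mu> U j (\<lambda>x. \<mu> * (real CARD('d) * (2 ^ j * (2 ^ j * c j ^ 2 * 2)) * h x))
    (\<lambda>x. \<Sum>l\<in>UNIV. (f x * g l x) * (- 2 * partial_deriv k (G l) x))"
proof -
  have G': "jet_bound \<mu> U j (\<lambda>_. 2 * \<mu>) (\<lambda>x. - 2 * partial_deriv k (G l) x)" for l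
    by (rule jet_bound_linear[OF open_U bounded_linear_mult_right _ _ jet_bound_weaken[OF jet_G mu_nonneg j]])
       (auto simp: abs_mult)
  have "jet_bound \<mu> U j (\<lambda>x. 2 ^ j * ((2 ^ j * ((c j * V x) * (c j * w x))) * (2 * \<mu>)))
      (\<lambda>x. (f x * g l x) * (- 2 * partial_deriv k (G l) x))" for l
    using jet_bound_scaleR[OF open_U mu_nonneg jet_bound_scaleR[OF open_U mu_nonneg f g[of l]] G'[of l]] by simp
  from jet_bound_sum[OF open_U mu_nonneg finite this]
  show ?thesis
  proof (rule jet_bound_weaken[OF _ mu_nonneg order_refl])
    fix x
    have "V x * w x \<le> h x"
      using V[of x] w_bounds(1,3)[of x] by (metis less_imp_le mult_right_mono)
    then have "(2 ^ j * (2 ^ j * c j ^ 2 * 2)) * \<mu> * (V x * w x) \<le> (2 ^ j * (2 ^ j * c j ^ 2 * 2)) * \<mu> * h x"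
      using mu_pos by (intro mult_left_mono) auto
    then have "real CARD('d) * ((2 ^ j * (2 ^ j * c j ^ 2 * 2)) * \<mu> * (V x * w x)) \<le> real CARD('d) * ((2 ^ j * (2 ^ j * c j ^ 2 * 2)) * \<mu> * h x)"
      by (rule mult_left_mono) simp
    moreover have "(\<Sum>l\<in>(UNIV :: 'd set). 2 ^ j * ((2 ^ j * ((c j * V x) * (c j * w x))) * (2 * \<mu>)))
        = real CARD('d) * ((2 ^ j * (2 ^ j * c j ^ 2 * 2)) * \<mu> * (V x * w x))"
      by (simp add: power2_eq_square mult_ac)
    moreover have "real CARD('d) * ((2 ^ j * (2 ^ j * c j ^ 2 * 2)) * \<mu> * h x)
        = \<mu> * (real CARD('d) * (2 ^ j * (2 ^ j * c j ^ 2 * 2)) * h x)"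
      by (simp add: mult_ac)
    ultimately show "(\<Sum>l\<in>(UNIV :: 'd set). 2 ^ j * ((2 ^ j * ((c j * V x) * (c j * w x))) * (2 * \<mu>)))
        \<le> \<mu> * (real CARD('d) * (2 ^ j * (2 ^ j * c j ^ 2 * 2)) * h x)"
      by linarith
  qed
qed

text \<open>The formulas for the derivatives express jets of order \<open>j + 1\<close> of \<open>h\<close> and \<open>b\<close> by their jets of order
\<open>j\<close>, so both are bounded in one induction.  The third conjunct records that the derivatives of \<open>b\<close>
decay like \<open>w^2\<close>, while \<open>b\<close> itself only decays like \<open>w\<close>.\<close>

lemma jet_h_b:
  "j \<le> CARD('d) \<Longrightarrow> jet_bound \<mu> U j (\<lambda>x. c j * h x) h \<and> (\<forall>i. jet_bound \<mu> U j (\<lambda>x. c j * w x) (b i)) \<and>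
    (\<forall>j' k i. j = Suc j' \<longrightarrow> jet_bound \<mu> U j' (\<lambda>x. \<mu> * (c j * h x)) (partial_deriv k (b i)))"
proof (induction j)
  case 0
  then show ?case using cont_h cont_b h_bounds b_bound by (auto simp: less_imp_le c_def)
next
  case (Suc j)
  then have j: "j \<le> CARD('d) - 1" "j \<le> CARD('d)" by auto
  from Suc.IH[OF j(2)] have IH: "jet_bound \<mu> U j (\<lambda>x. c j * h x) h" "\<And>i. jet_bound \<mu> U j (\<lambda>x. c j * w x) (b i)" by auto
  have cS: "c (Suc j) = c j + 2 ^ j * c j + real CARD('d) * (2 ^ j * (2 ^ j * c j ^ 2 * 2))" by (simp add: c_def)
  have c1: "1 \<le> c j" "1 \<le> c (Suc j)" unfolding c_def by (rule phase_const_ge_1, simp)+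
  note hw = h_bounds w_bounds
  have dh: "jet_bound \<mu> U j (\<lambda>x. \<mu> * (c (Suc j) * h x))
      (\<lambda>x. \<Sum>l\<in>UNIV. (h x * b l x) * (- 2 * partial_deriv k (G l) x))" for k
  proof (rule jet_bound_weaken[OF jet_bound_triple_product[OF j(1) IH] mu_nonneg order_refl])
    fix x
    show "h x \<le> w x" "0 \<le> h x" using hw by (auto simp: less_imp_le)
    show "\<mu> * (real CARD('d) * (2 ^ j * (2 ^ j * c j ^ 2 * 2)) * h x) \<le> \<mu> * (c (Suc j) * h x)"
      unfolding cS using c1 h_bounds[of x] mu_pos by (intro mult_left_mono mult_right_mono) auto
  qed
  have db0: "jet_bound \<mu> U j (\<lambda>x. \<mu> * (c (Suc j) * h x))
      (\<lambda>x. h x * partial_deriv k (G i) x + (\<Sum>l\<in>UNIV. (b i x * b l x) * (- 2 * partial_deriv k (G l) x)))" for k i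
  proof -
    have "jet_bound \<mu> U j (\<lambda>x. 2 ^ j * ((c j * h x) * \<mu>)) (\<lambda>x. h x * partial_deriv k (G i) x)"
      using jet_bound_scaleR[OF open_U mu_nonneg IH(1) jet_bound_weaken[OF jet_G mu_nonneg j(1) order_refl]] by simp
    from jet_bound_add[OF open_U this jet_bound_triple_product[where k = k, OF j(1) IH(2)[of i] IH(2) order_refl less_imp_le[OF w_bounds(1)]]]
    show ?thesis
    proof (rule jet_bound_weaken[OF _ mu_nonneg order_refl])
      fix x
      have "0 \<le> \<mu> * c j * h x" using c1 mu_pos h_bounds[of x] by simp
      then show "2 ^ j * ((c j * h x) * \<mu>) + \<mu> * (real CARD('d) * (2 ^ j * (2 ^ j * c j ^ 2 * 2)) * h x) \<le> \<mu> * (c (Suc j) * h x)"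
        unfolding cS by (simp add: algebra_simps)
    qed
  qed
  have pb: "has_partial k (b i) (h x * partial_deriv k (G i) x + (\<Sum>l\<in>UNIV. (b i x * b l x) * (- 2 * partial_deriv k (G l) x))) x"
    if "x \<in> U" for k i x
    using has_partial_b_formula[OF that, of k i] by (simp add: mult.commute)
  have db: "jet_bound \<mu> U j (\<lambda>x. \<mu> * (c (Suc j) * h x)) (partial_deriv k (b i))" for k i
    by (rule jet_bound_cong[OF open_U db0]) (use pb in \<open>auto simp: has_partial_iff\<close>)
  have Jh: "jet_bound \<mu> U (Suc j) (\<lambda>x. c (Suc j) * h x) h"
  proof (rule jet_bound_SucI[OF open_U cont_h _ has_partial_h dh])
    show "norm (h x) \<le> c (Suc j) * h x" for x
      using c1(2) h_bounds[of x] by simp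
  qed
  have Jb: "jet_bound \<mu> U (Suc j) (\<lambda>x. c (Suc j) * w x) (b i)" for i
  proof (rule jet_bound_SucI[OF open_U cont_b _ pb])
    show "norm (b i x) \<le> c (Suc j) * w x" for x
    proof -
      have "1 * w x \<le> c (Suc j) * w x" using c1(2) w_bounds(1)[of x] by (intro mult_right_mono) auto
      with b_bound[of i x] show ?thesis by simp
    qed
    show "jet_bound \<mu> U j (\<lambda>x. \<mu> * (c (Suc j) * w x))
      (\<lambda>x. h x * partial_deriv k (G i) x + (\<Sum>l\<in>UNIV. (b i x * b l x) * (- 2 * partial_deriv k (G l) x)))" for k
      by (rule jet_bound_weaken[OF db0 mu_nonneg order_refl])
         (use c1 mu_pos hw in \<open>auto intro!: mult_left_mono\<close>)
  qed
  show ?case using Jh Jb db by blast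
qed

section \<open>Repeated integration by parts\<close>

text \<open>As \<open>\<mu> / r = lam\<close>, this is the oscillating factor \<open>exp (\<i> lam \<Phi>)\<close>.\<close>

definition osc :: "real ^ 'd \<Rightarrow> complex" where
  "osc x = exp (\<i> * complex_of_real (\<mu> / r * \<Phi> x))"

definition supported :: "(real ^ 'd \<Rightarrow> complex) \<Rightarrow> bool" where
  "supported f \<longleftrightarrow> (\<forall>x. x \<notin> K \<longrightarrow> f x = 0)"

definition cD where "cD = c CARD('d)"
definition mass where "mass = (LINT x|lborel. indicator K x * w x ^ (CARD('d) + 1))"

lemma norm_osc [simp]: "norm (osc x) = 1"
  by (simp add: osc_def norm_exp_i_times)

lemma cont_osc: "continuous_on U osc"
  unfolding osc_def[abs_def] by (intro continuous_intros cont_Phi)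

lemma has_partial_osc: "x \<in> U \<Longrightarrow> has_partial i osc (osc x * (\<i> * complex_of_real (\<mu> * G i x))) x"
  unfolding osc_def[abs_def] using has_partial_exp_phase[OF has_partial_Phi, of x i "\<mu> / r"] r_pos by simp

lemma cD_ge_1: "1 \<le> cD"
  by (subst cD_def, subst c_def) (rule phase_const_ge_1, simp)

lemma jet_h: "jet_bound \<mu> U CARD('d) (\<lambda>x. cD * h x) h"
  and jet_b: "jet_bound \<mu> U CARD('d) (\<lambda>x. cD * w x) (b i)"
  using jet_h_b[OF order_refl] by (auto simp: cD_def)

lemma jet_partial_b: "jet_bound \<mu> U (CARD('d) - 1) (\<lambda>x. \<mu> * (cD * h x)) (partial_deriv k (b i))"
proof -
  have "CARD('d) = Suc (CARD('d) - 1)" by simp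
  with jet_h_b[OF order_refl] show ?thesis unfolding cD_def by blast
qed

lemma has_partial_b: "x \<in> U \<Longrightarrow> has_partial k (b i) (partial_deriv k (b i) x) x"
  using has_partial_b_formula by (simp add: has_partial_iff)

lemma closed_K: "closed K" using compact_K by (rule compact_imp_closed)

lemma integrable_supported:
  fixes f :: "real ^ 'd \<Rightarrow> complex"
  assumes "continuous_on U f" "supported f"
  shows "integrable lborel (\<lambda>x. osc x * f x)"
proof (rule integrable_compact_support[OF compact_K])
  show "continuous_on K (\<lambda>x. osc x * f x)"
    by (intro continuous_intros continuous_on_subset[OF cont_osc K_U] continuous_on_subset[OF assms(1) K_U])
qed (use assms(2) in \<open>simp add: supported_def\<close>)

lemma supported_partial: "supported f \<Longrightarrow> supported (partial_deriv i f)"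
  using has_partial_off_support[OF closed_K] by (auto simp: supported_def has_partial_iff)

text \<open>The divergence of the compactly supported field \<open>osc * f * b\<close> has integral zero.  Differentiating
\<open>osc\<close> produces \<open>\<i> * \<mu> * (G \<cdot> b) * osc * f\<close>, and \<open>G \<cdot> b = 1 - h\<close>; solving for \<open>osc * f\<close> gives the identity.
The terms are grouped by their behaviour in lemma \<open>decay\<close>: the first integral gains one factor \<open>w\<close>
and loses a derivative of \<open>f\<close>, the second gains \<open>w^2\<close> and differentiates \<open>b\<close>.\<close>

lemma integration_by_parts:
  fixes f :: "real ^ 'd \<Rightarrow> complex"
  assumes jet: "jet_bound \<mu> U 1 W f" and supp: "supported f"
  shows "(LINT x|lborel. osc x * f x) =
    (LINT x|lborel. osc x * (h x *\<^sub>R f x + (\<i> / of_real \<mu>) * (\<Sum>k\<in>UNIV. b k x *\<^sub>R partial_deriv k f x))) +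
    (LINT x|lborel. osc x * ((\<i> / of_real \<mu>) * (\<Sum>k\<in>UNIV. partial_deriv k (b k) x *\<^sub>R f x)))"
proof -
  have mu_nz: "\<mu> \<noteq> 0" using mu_pos by simp
  note jet1 = jet[unfolded One_nat_def]
  have cf: "continuous_on U f" "continuous_on U (partial_deriv k f)" for k
    using jet_boundD(1)[OF jet] jet_boundD(1)[OF jet_bound_SucD(2)[OF jet1]] by auto
  have cb: "continuous_on U (partial_deriv k (b k))" for k
    using jet_boundD(1)[OF jet_partial_b] .
  have s: "f x = 0" "partial_deriv k f x = 0" if "x \<notin> K" for x k
    using supp supported_partial[OF supp] that by (auto simp: supported_def)
  \<comment> \<open>\<open>F\<close> is the field whose divergence is integrated; \<open>F' k\<close> is the \<open>k\<close>-th summand of that divergence.\<close>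
  define F where "F k x = osc x * (b k x *\<^sub>R f x)" for k x
  define F' where "F' k x = osc x * (\<i> * of_real (\<mu> * (G k x * b k x)) * f x + b k x *\<^sub>R partial_deriv k f x + partial_deriv k (b k) x *\<^sub>R f x)" for k x
  have F'cU: "continuous_on U (F' k)" for k
    unfolding F'_def[abs_def] by (intro continuous_intros cont_osc cont_G cont_b cf cb)
  have F'c: "continuous_on UNIV (F' k)" for k
    by (rule continuous_on_extend_by_zero[OF open_U closed_K K_U F'cU]) (simp add: F'_def s)
  have Fc: "continuous_on UNIV (F k)" for k
  proof (rule continuous_on_extend_by_zero[OF open_U closed_K K_U])
    show "continuous_on U (F k)"
      unfolding F_def[abs_def] by (intro continuous_intros cont_osc cont_b cf)
  qed (simp add: F_def s)
  have pF: "has_partial k (F k) (F' k x) x" for k x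
  proof (cases "x \<in> U")
    case True
    have "has_partial k (F k) (osc x * (b k x *\<^sub>R partial_deriv k f x + partial_deriv k (b k) x *\<^sub>R f x)
        + (osc x * (\<i> * complex_of_real (\<mu> * G k x))) * (b k x *\<^sub>R f x)) x"
      unfolding F_def[abs_def]
      by (intro has_partial_mult has_partial_scaleR has_partial_osc has_partial_b jet_bound_SucD(1)[OF jet1] True)
    also have "osc x * (b k x *\<^sub>R partial_deriv k f x + partial_deriv k (b k) x *\<^sub>R f x)
        + (osc x * (\<i> * complex_of_real (\<mu> * G k x))) * (b k x *\<^sub>R f x) = F' k x"
      by (simp add: F'_def scaleR_conv_of_real algebra_simps)
    finally show ?thesis .
  next
    case False
    then have "x \<notin> K" using K_U by auto
    then have "has_partial k (F k) 0 x"
      by (intro has_partial_off_support[OF closed_K]) (auto simp: F_def s)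
    moreover have "F' k x = 0" using \<open>x \<notin> K\<close> by (simp add: F'_def s)
    ultimately show ?thesis by simp
  qed
  have I0: "(LINT x|lborel. F' k x) = 0" for k
    by (rule integral_partial_deriv_eq_0[OF pF Fc F'c compact_K]) (simp add: F_def s)
  have intF': "integrable lborel (F' k)" for k
    by (rule integrable_compact_support[OF compact_K continuous_on_subset[OF F'c]]) (auto simp: F'_def s)
  let ?f1 = "\<lambda>x. h x *\<^sub>R f x + (\<i> / of_real \<mu>) * (\<Sum>k\<in>UNIV. b k x *\<^sub>R partial_deriv k f x)"
  let ?f2 = "\<lambda>x. (\<i> / of_real \<mu>) * (\<Sum>k\<in>UNIV. partial_deriv k (b k) x *\<^sub>R f x)"
  have int1: "integrable lborel (\<lambda>x. osc x * ?f1 x)"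
    by (rule integrable_supported) (auto intro!: continuous_intros cont_h cont_b cf simp: supported_def s mu_nz)
  have int2: "integrable lborel (\<lambda>x. osc x * ?f2 x)"
    by (rule integrable_supported) (auto intro!: continuous_intros cb cf simp: supported_def s mu_nz)
  have id: "osc x * f x = (osc x * ?f1 x + osc x * ?f2 x) - (\<i> / of_real \<mu>) * (\<Sum>k\<in>UNIV. F' k x)" for x
  proof -
    let ?S = "\<Sum>k\<in>UNIV. b k x *\<^sub>R partial_deriv k f x" and ?T = "\<Sum>k\<in>UNIV. partial_deriv k (b k) x *\<^sub>R f x"
    have "(\<Sum>k\<in>UNIV. F' k x) = osc x * (\<i> * of_real (\<mu> * (\<Sum>k\<in>UNIV. G k x * b k x)) * f x + ?S + ?T)"
      unfolding F'_def sum_distrib_left[symmetric] sum.distrib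
      by (simp add: sum_distrib_left sum_distrib_right)
    also have "\<dots> = osc x * (\<i> * of_real \<mu> * (f x - h x *\<^sub>R f x) + ?S + ?T)"
      unfolding sum_G_b by (simp add: scaleR_conv_of_real algebra_simps)
    finally have sumF': "(\<Sum>k\<in>UNIV. F' k x) = osc x * (\<i> * of_real \<mu> * (f x - h x *\<^sub>R f x) + ?S + ?T)" .
    have "z * (o' * (m * y + S + T)) = o' * (z * m * y + z * S + z * T)" for z o' m y S T :: complex
      by (simp add: algebra_simps)
    from this[of "\<i> / of_real \<mu>" "osc x" "\<i> * of_real \<mu>"]
    have "(\<i> / of_real \<mu>) * (\<Sum>k\<in>UNIV. F' k x)
      = osc x * ((\<i> / of_real \<mu>) * (\<i> * of_real \<mu>) * (f x - h x *\<^sub>R f x) + (\<i> / of_real \<mu>) * ?S + (\<i> / of_real \<mu>) * ?T)"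
      unfolding sumF' .
    also have "(\<i> / of_real \<mu>) * (\<i> * of_real \<mu>) = (- 1 :: complex)"
      using mu_pos by (simp add: field_simps)
    finally show ?thesis by (simp add: algebra_simps)
  qed
  have intS: "integrable lborel (\<lambda>x. (\<i> / of_real \<mu>) * (\<Sum>k\<in>UNIV. F' k x))"
    by (intro integrable_mult_right Bochner_Integration.integrable_sum intF')
  have IS: "(LINT x|lborel. (\<i> / of_real \<mu>) * (\<Sum>k\<in>UNIV. F' k x)) = 0"
    using intF' I0 by simp
  have "(LINT x|lborel. osc x * f x) = (LINT x|lborel. (osc x * ?f1 x + osc x * ?f2 x) - (\<i> / of_real \<mu>) * (\<Sum>k\<in>UNIV. F' k x))"
    by (simp only: id[symmetric])
  also have "\<dots> = (LINT x|lborel. osc x * ?f1 x + osc x * ?f2 x) - (LINT x|lborel. (\<i> / of_real \<mu>) * (\<Sum>k\<in>UNIV. F' k x))"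
    by (intro Bochner_Integration.integral_diff Bochner_Integration.integrable_add int1 int2 intS)
  also have "\<dots> = (LINT x|lborel. osc x * ?f1 x) + (LINT x|lborel. osc x * ?f2 x)"
    unfolding IS diff_zero by (rule Bochner_Integration.integral_add[OF int1 int2])
  finally show ?thesis .
qed

definition step_const where "step_const = (1 + 2 * real CARD('d)) * (2 ^ CARD('d) * cD)"

lemma step_const_ge_1: "1 \<le> step_const"
proof -
  have "1 * (1 * 1) \<le> (1 + 2 * real CARD('d)) * (2 ^ CARD('d) * cD)"
    using cD_ge_1 by (intro mult_mono) auto
  then show ?thesis by (simp add: step_const_def)
qed

lemma mass_nonneg: "0 \<le> mass"
  unfolding mass_def by (rule integral_nonneg_AE) (use w_bounds(1) in \<open>simp add: less_imp_le\<close>)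

lemma jet_bound_mult_i_div_mu:
  assumes "jet_bound \<mu> U k (\<lambda>x. \<mu> * W x) f"
  shows "jet_bound \<mu> U k W (\<lambda>x. (\<i> / of_real \<mu>) * f x)"
proof -
  have "jet_bound \<mu> U k (\<lambda>x. (1 / \<mu>) * (\<mu> * W x)) (\<lambda>x. (\<i> / of_real \<mu>) * f x)"
    by (rule jet_bound_linear[OF open_U bounded_linear_mult_right _ _ assms]) (use mu_pos in \<open>auto simp: norm_mult norm_divide\<close>)
  then show ?thesis using mu_pos by simp
qed

lemma decay_base:
  fixes f :: "real ^ 'd \<Rightarrow> complex"
  assumes p: "CARD('d) + 1 \<le> p" and M: "0 \<le> M"
    and jet: "jet_bound \<mu> U j (\<lambda>x. M * w x ^ p) f" and supp: "supported f"
  shows "norm (LINT x|lborel. osc x * f x) \<le> step_const ^ q * M * mass"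
proof -
  have "norm (LINT x|lborel. osc x * f x) \<le> (LINT x|lborel. indicator K x * (M * w x ^ (CARD('d) + 1)))"
  proof (rule norm_integral_le_on_compact[OF compact_K])
    show "continuous_on K (\<lambda>x. M * w x ^ (CARD('d) + 1))"
      by (intro continuous_intros continuous_on_subset[OF cont_w K_U])
    fix x
    assume "x \<in> K"
    then have "norm (osc x * f x) \<le> M * w x ^ p"
      using jet_boundD(2)[OF jet] K_U by (auto simp: norm_mult)
    also have "\<dots> \<le> M * w x ^ (CARD('d) + 1)"
      using w_bounds(1,2)[of x] p M by (intro mult_left_mono power_decreasing) auto
    finally show "norm (osc x * f x) \<le> M * w x ^ (CARD('d) + 1)" .
  qed (use supp in \<open>simp add: supported_def\<close>)
  also have "\<dots> = M * mass"
    unfolding mass_def by (simp add: mult.left_commute)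
  also have "\<dots> \<le> step_const ^ q * (M * mass)"
    using mult_right_mono[OF one_le_power[OF step_const_ge_1, of q], of "M * mass"] M mass_nonneg by simp
  finally show ?thesis by (simp add: mult.assoc)
qed

text \<open>The number \<open>q\<close> bounds how many further integrations by parts are needed to reach the exponent
\<open>d + 1\<close>.  Of the two amplitudes that arise, the first has \<open>min d (j - 1)\<close> derivatives and decays like
\<open>w ^ (p + 1)\<close>, the second has \<open>min (d - 1) j\<close> derivatives and decays like \<open>w ^ (p + 2)\<close>.  Both again
satisfy \<open>d + 1 \<le> j + p\<close>, which is why \<open>d\<close> derivatives of \<open>G\<close> suffice.\<close>

lemma decay:
  fixes f :: "real ^ 'd \<Rightarrow> complex"
  assumes "CARD('d) + 1 \<le> q + p" "CARD('d) + 1 \<le> j + p" "0 \<le> M"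
    "jet_bound \<mu> U j (\<lambda>x. M * w x ^ p) f" "supported f"
  shows "norm (LINT x|lborel. osc x * f x) \<le> step_const ^ q * M * mass"
  using assms
proof (induction q arbitrary: p j M f)
  case 0
  then show ?case by (intro decay_base) auto
next
  case (Suc q)
  show ?case
  proof (cases "CARD('d) + 1 \<le> p")
    case True
    then show ?thesis using decay_base Suc.prems by blast
  next
    case False
    then have j1: "1 \<le> j" using Suc.prems(2) by simp
    note M = \<open>0 \<le> M\<close>
    let ?d = "CARD('d)"
    let ?f1 = "\<lambda>x. h x *\<^sub>R f x + (\<i> / of_real \<mu>) * (\<Sum>k\<in>UNIV. b k x *\<^sub>R partial_deriv k f x)"
    let ?f2 = "\<lambda>x. (\<i> / of_real \<mu>) * (\<Sum>k\<in>UNIV. partial_deriv k (b k) x *\<^sub>R f x)"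
    define B where "B = 2 ^ ?d * cD * M"
    have B: "0 \<le> B" using M cD_ge_1 by (simp add: B_def)
    have jetS: "jet_bound \<mu> U (Suc (j - 1)) (\<lambda>x. M * w x ^ p) f" using Suc.prems(4) j1 by simp
    have sf: "f x = 0" "partial_deriv k f x = 0" if "x \<notin> K" for x k
      using Suc.prems(5) supported_partial[OF Suc.prems(5)] that by (auto simp: supported_def)
    have pow2: "(2::real) ^ k \<le> 2 ^ ?d" if "k \<le> ?d" for k using that by simp
    have wp: "0 \<le> w x" for x using w_bounds(1)[of x] by simp

    \<comment> \<open>The first amplitude uses \<open>d\<close> derivatives of \<open>b\<close> at most and one derivative of \<open>f\<close>.\<close>
    define k1 where "k1 = min ?d (j - 1)"
    have hf: "jet_bound \<mu> U k1 (\<lambda>x. B * w x ^ (p + 1)) (\<lambda>x. h x *\<^sub>R f x)"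
    proof (rule jet_bound_weaken[OF jet_bound_scaleR[OF open_U mu_nonneg
              jet_bound_weaken[OF jet_h mu_nonneg _ order_refl] jet_bound_weaken[OF Suc.prems(4) mu_nonneg _ order_refl]] mu_nonneg order_refl])
      show "k1 \<le> ?d" "k1 \<le> j" by (auto simp: k1_def)
      show "2 ^ k1 * ((cD * h x) * (M * w x ^ p)) \<le> B * w x ^ (p + 1)" for x
      proof -
        have "2 ^ k1 * ((cD * h x) * (M * w x ^ p)) \<le> 2 ^ ?d * ((cD * w x) * (M * w x ^ p))"
          using pow2[OF \<open>k1 \<le> ?d\<close>] cD_ge_1 w_bounds(5)[of x] h_bounds(1)[of x] M wp[of x]
          by (intro mult_mono) auto
        then show ?thesis by (simp add: B_def mult_ac)
      qed
    qed
    have bf: "jet_bound \<mu> U k1 (\<lambda>x. \<mu> * (B * w x ^ (p + 1))) (\<lambda>x. b k x *\<^sub>R partial_deriv k f x)" for k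
    proof (rule jet_bound_weaken[OF jet_bound_scaleR[OF open_U mu_nonneg
              jet_bound_weaken[OF jet_b mu_nonneg _ order_refl] jet_bound_weaken[OF jet_bound_SucD(2)[OF jetS] mu_nonneg _ order_refl]] mu_nonneg order_refl])
      show "k1 \<le> ?d" "k1 \<le> j - 1" by (auto simp: k1_def)
      show "2 ^ k1 * ((cD * w x) * (\<mu> * (M * w x ^ p))) \<le> \<mu> * (B * w x ^ (p + 1))" for x
      proof -
        have "2 ^ k1 * ((cD * w x) * (\<mu> * (M * w x ^ p))) \<le> 2 ^ ?d * ((cD * w x) * (\<mu> * (M * w x ^ p)))"
          using pow2[OF \<open>k1 \<le> ?d\<close>] cD_ge_1 M wp[of x] mu_pos by (intro mult_right_mono) auto
        then show ?thesis by (simp add: B_def mult_ac)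
      qed
    qed
    have "jet_bound \<mu> U k1 (\<lambda>x. \<mu> * (real ?d * B * w x ^ (p + 1))) (\<lambda>x. \<Sum>k\<in>UNIV. b k x *\<^sub>R partial_deriv k f x)"
      using jet_bound_sum[OF open_U mu_nonneg finite bf] by (simp add: mult_ac)
    from jet_bound_add[OF open_U hf jet_bound_mult_i_div_mu[OF this]]
    have jet_f1: "jet_bound \<mu> U k1 (\<lambda>x. ((1 + real ?d) * B) * w x ^ (p + 1)) ?f1"
      by (simp add: algebra_simps)

    \<comment> \<open>In the second amplitude \<open>b\<close> has already been differentiated once, while \<open>f\<close> has not.\<close>
    define k2 where "k2 = min (?d - 1) j"
    have df: "jet_bound \<mu> U k2 (\<lambda>x. \<mu> * (B * w x ^ (p + 2))) (\<lambda>x. partial_deriv k (b k) x *\<^sub>R f x)" for k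
    proof (rule jet_bound_weaken[OF jet_bound_scaleR[OF open_U mu_nonneg
              jet_bound_weaken[OF jet_partial_b mu_nonneg _ order_refl] jet_bound_weaken[OF Suc.prems(4) mu_nonneg _ order_refl]] mu_nonneg order_refl])
      show k2: "k2 \<le> ?d - 1" "k2 \<le> j" by (auto simp: k2_def)
      show "2 ^ k2 * ((\<mu> * (cD * h x)) * (M * w x ^ p)) \<le> \<mu> * (B * w x ^ (p + 2))" for x
      proof -
        have "2 ^ k2 * ((\<mu> * (cD * h x)) * (M * w x ^ p)) \<le> 2 ^ ?d * ((\<mu> * (cD * h x)) * (M * w x ^ p))"
          using pow2[of k2] k2 cD_ge_1 M wp[of x] mu_pos h_bounds(1)[of x] by (intro mult_right_mono) auto
        then show ?thesis by (simp add: B_def w_bounds(4)[of x, symmetric] power_add power2_eq_square mult_ac)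
      qed
    qed
    have "jet_bound \<mu> U k2 (\<lambda>x. \<mu> * (real ?d * B * w x ^ (p + 2))) (\<lambda>x. \<Sum>k\<in>UNIV. partial_deriv k (b k) x *\<^sub>R f x)"
      using jet_bound_sum[OF open_U mu_nonneg finite df] by (simp add: mult_ac)
    from jet_bound_mult_i_div_mu[OF this]
    have jet_f2: "jet_bound \<mu> U k2 (\<lambda>x. (real ?d * B) * w x ^ (p + 2)) ?f2" .

    have dpos: "0 < ?d" by simp
    have 1: "norm (LINT x|lborel. osc x * ?f1 x) \<le> step_const ^ q * ((1 + real ?d) * B) * mass"
      by (rule Suc.IH[OF _ _ _ jet_f1]) (use Suc.prems(1,2) j1 B dpos in \<open>auto simp: supported_def sf k1_def\<close>)
    have 2: "norm (LINT x|lborel. osc x * ?f2 x) \<le> step_const ^ q * (real ?d * B) * mass"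
      by (rule Suc.IH[OF _ _ _ jet_f2]) (use Suc.prems(1,2) B dpos in \<open>auto simp: supported_def sf k2_def\<close>)
    have "(LINT x|lborel. osc x * f x) = (LINT x|lborel. osc x * ?f1 x) + (LINT x|lborel. osc x * ?f2 x)"
      by (rule integration_by_parts[OF jet_bound_weaken[OF Suc.prems(4) mu_nonneg j1 order_refl] Suc.prems(5)])
    also have "norm \<dots> \<le> step_const ^ q * ((1 + real ?d) * B) * mass + step_const ^ q * (real ?d * B) * mass"
      by (rule norm_triangle_le[OF add_mono[OF 1 2]])
    also have "\<dots> = step_const ^ Suc q * M * mass"
      by (simp add: step_const_def B_def algebra_simps)
    finally show ?thesis .
  qed
qed

section \<open>The mass of the weight\<close>

definition \<Gamma> where "\<Gamma> x = (\<chi> i. G i x)"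

lemma cont_Gamma: "continuous_on U \<Gamma>"
  unfolding \<Gamma>_def[abs_def] by (intro continuous_on_vec_lambda cont_G)

lemma norm_Gamma: "(norm (\<Gamma> x))\<^sup>2 = (\<Sum>i\<in>UNIV. (G i x)\<^sup>2)"
  by (simp add: \<Gamma>_def norm_vec_def L2_set_def sum_nonneg)

lemma weight_le_inverse:
  assumes "0 < R" "R \<le> norm (\<Gamma> x)"
  shows "w x \<le> 1 / R"
proof -
  have "R\<^sup>2 \<le> 1 + (\<Sum>i\<in>UNIV. (G i x)\<^sup>2)"
    using assms power_mono[of R "norm (\<Gamma> x)" 2] norm_Gamma[of x] by simp
  then have "h x \<le> inverse (R\<^sup>2)"
    unfolding h_def using assms by (intro le_imp_inverse_le) auto
  then have "w x \<le> sqrt ((1 / R)\<^sup>2)"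
    unfolding w_def by (intro real_sqrt_le_mono) (simp add: power_divide inverse_eq_divide)
  then show ?thesis using assms by simp
qed

lemma Gamma_derivative:
  assumes "x \<in> U"
  shows "((\<lambda>x. r *\<^sub>R \<Gamma> x) has_derivative (\<lambda>v. \<chi> i. \<Sum>k\<in>UNIV. v $ k * (r * partial_deriv k (G i) x))) (at x)"
proof (rule has_derivative_componentwise_within[THEN iffD2], rule ballI)
  fix e :: "real ^ 'd" assume "e \<in> Basis"
  then obtain i where e: "e = axis i 1" by (auto simp: Basis_vec_def)
  have "(G i has_derivative (\<lambda>v. \<Sum>k\<in>UNIV. v $ k * partial_deriv k (G i) x)) (at x)"
    by (rule has_derivative_of_continuous_partials[OF open_U assms diff_G jet_boundD(1)[OF jet_G]])
  from has_derivative_scaleR_right[OF this, of r]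
  show "((\<lambda>x. (r *\<^sub>R \<Gamma> x) \<bullet> e) has_derivative (\<lambda>v. (\<chi> i. \<Sum>k\<in>UNIV. v $ k * (r * partial_deriv k (G i) x)) \<bullet> e)) (at x)"
    by (simp add: e inner_axis \<Gamma>_def sum_distrib_left mult.left_commute)
qed

text \<open>The map \<open>r * G\<close> is injective, sends the sublevel set into the ball of radius \<open>r * R\<close>, and expands
volumes by at least \<open>L\<close>.\<close>

lemma sublevel_measure:
  assumes bdd: "bounded U" and inj: "inj_on (\<lambda>x. r *\<^sub>R \<Gamma> x) U"
    and L: "0 < L" "\<And>x. x \<in> U \<Longrightarrow> L \<le> \<bar>det (\<chi> i k. r * partial_deriv k (G i) x)\<bar>"
    and R: "0 \<le> R"
  shows "open {x \<in> U. norm (\<Gamma> x) < R}"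
    and "measure lborel {x \<in> U. norm (\<Gamma> x) < R} \<le> unit_ball_vol (real CARD('d)) * (r * R) ^ CARD('d) / L"
proof -
  let ?S = "{x \<in> U. norm (\<Gamma> x) < R}"
  have "?S = U \<inter> \<Gamma> -` ball 0 R" by auto
  then show op: "open ?S"
    using continuous_open_preimage[OF cont_Gamma open_U open_ball] by simp
  have "L * measure lborel ?S \<le> measure lborel (ball (0 :: real ^ 'd) (r * R))"
  proof (rule measure_le_image[OF op])
    show "bounded ?S" using bdd by (rule bounded_subset) auto
    show "((\<lambda>x. r *\<^sub>R \<Gamma> x) has_derivative (\<lambda>v. \<chi> i. \<Sum>k\<in>UNIV. v $ k * (r * partial_deriv k (G i) x))) (at x)" if "x \<in> ?S" for x
      by (rule Gamma_derivative) (use that in auto)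
    show "inj_on (\<lambda>x. r *\<^sub>R \<Gamma> x) ?S" using inj by (rule inj_on_subset) auto
    show "(\<lambda>x. r *\<^sub>R \<Gamma> x) ` ?S \<subseteq> ball 0 (r * R)" using r_pos by auto
    show "L \<le> \<bar>det (matrix (\<lambda>v :: real ^ 'd. \<chi> i. \<Sum>k\<in>UNIV. v $ k * (r * partial_deriv k (G i) x)))\<bar>" if "x \<in> ?S" for x
    proof -
      have "matrix (\<lambda>v :: real ^ 'd. \<chi> i. \<Sum>k\<in>UNIV. v $ k * (r * partial_deriv k (G i) x)) = (\<chi> i k. r * partial_deriv k (G i) x)"
        by (simp add: matrix_def vec_eq_iff sum_axis_mult)
      then show ?thesis using L(2)[of x] that by simp
    qed
  qed (use L in auto)
  also have "\<dots> = unit_ball_vol (real CARD('d)) * (r * R) ^ CARD('d)"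
    by (rule measure_ball_cart) (use r_pos R in simp)
  finally show "measure lborel ?S \<le> unit_ball_vol (real CARD('d)) * (r * R) ^ CARD('d) / L"
    using L(1) by (simp add: pos_le_divide_eq mult.commute)
qed

text \<open>A point at which \<open>|G|\<close> is of size \<open>2 ^ m\<close> has weight \<open>w ^ (d + 1)\<close> of order \<open>2 ^ (- m (d + 1))\<close>, while
such points fill a volume of order \<open>(2 ^ m r) ^ d / L\<close>.  The products form a geometric series.\<close>

lemma mass_le:
  assumes bdd: "bounded U" and inj: "inj_on (\<lambda>x. r *\<^sub>R \<Gamma> x) U"
    and L: "0 < L" "\<And>x. x \<in> U \<Longrightarrow> L \<le> \<bar>det (\<chi> i k. r * partial_deriv k (G i) x)\<bar>"
  shows "mass \<le> 2 ^ (CARD('d) + 2) * unit_ball_vol (real CARD('d)) * r ^ CARD('d) / L"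
proof -
  let ?n = "CARD('d) + 1"
  define S where "S m = {x \<in> U. norm (\<Gamma> x) < 2 ^ m}" for m :: nat
  define V where "V = unit_ball_vol (real CARD('d)) * r ^ CARD('d) / L"
  have V: "0 \<le> V" using r_pos L by (simp add: V_def)
  have S: "open (S m)" "measure lborel (S m) \<le> V * (2 ^ m) ^ CARD('d)" for m
    using sublevel_measure[OF bdd inj L, of "2 ^ m"] by (simp_all add: S_def V_def power_mult_distrib)
  have intS: "integrable lborel (indicator (S m) :: _ \<Rightarrow> real)" for m
  proof (rule integrable_real_indicator)
    show "emeasure lborel (S m) < \<infinity>"
      by (rule emeasure_bounded_finite, rule bounded_subset[OF bdd]) (auto simp: S_def)
  qed (use S in auto)
  have "bounded (\<Gamma> ` K)"
    by (intro compact_imp_bounded compact_continuous_image compact_K continuous_on_subset[OF cont_Gamma K_U])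
  then obtain B where B: "\<And>x. x \<in> K \<Longrightarrow> norm (\<Gamma> x) \<le> B" by (auto simp: bounded_iff)
  obtain N where N: "B < 2 ^ N" using real_arch_pow[of 2 B] by auto
  define a :: "nat \<Rightarrow> real" where "a m = 2 ^ ?n / (2 ^ m) ^ ?n" for m :: nat
  have a: "0 \<le> a m" for m by (simp add: a_def)
  have pt: "indicator K x * w x ^ ?n \<le> (\<Sum>m\<le>N. a m * indicator (S m) x)" for x
  proof (cases "x \<in> K")
    case True
    \<comment> \<open>By minimality \<open>|G|\<close> is at least \<open>2 ^ (m - 1)\<close> unless \<open>m = 0\<close>; this loss of a factor two in \<open>w\<close> is the factor \<open>2 ^ (d + 1)\<close> in \<open>a\<close>.\<close>
    define m where "m = (LEAST m. norm (\<Gamma> x) < 2 ^ m)"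
    have ex: "norm (\<Gamma> x) < 2 ^ N" using B[OF True] N by simp
    have m: "norm (\<Gamma> x) < 2 ^ m" "m \<le> N"
      unfolding m_def using ex by (rule LeastI, rule Least_le)
    have "w x \<le> 2 / 2 ^ m"
    proof (cases m)
      case 0
      then show ?thesis using w_bounds(2)[of x] by simp
    next
      case (Suc m')
      then have "\<not> norm (\<Gamma> x) < 2 ^ m'" unfolding m_def by (metis lessI not_less_Least)
      then have "w x \<le> 1 / 2 ^ m'" by (intro weight_le_inverse) auto
      then show ?thesis using Suc by simp
    qed
    then have "w x ^ ?n \<le> (2 / 2 ^ m) ^ ?n"
      using w_bounds(1)[of x] by (intro power_mono) auto
    also have "\<dots> = a m" by (simp only: a_def power_divide)
    also have "\<dots> = a m * indicator (S m) x"
      using m(1) True K_U by (auto simp: S_def)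
    also have "\<dots> \<le> (\<Sum>m\<le>N. a m * indicator (S m) x)"
      by (rule member_le_sum) (use m(2) a in auto)
    finally show ?thesis using True by simp
  qed (simp add: a sum_nonneg)
  have "mass \<le> (LINT x|lborel. (\<Sum>m\<le>N. a m * indicator (S m) x))"
    unfolding mass_def
  proof (rule integral_mono[OF _ _ pt])
    have "continuous_on K (\<lambda>x. w x ^ ?n)"
      by (intro continuous_intros continuous_on_subset[OF cont_w K_U])
    from borel_integrable_compact[OF compact_K this]
    show "integrable lborel (\<lambda>x. indicator K x * w x ^ ?n)" by simp
    show "integrable lborel (\<lambda>x. \<Sum>m\<le>N. a m * indicator (S m) x)"
      by (intro Bochner_Integration.integrable_sum integrable_mult_right intS)
  qed
  also have "\<dots> = (\<Sum>m\<le>N. LINT x|lborel. a m * indicator (S m) x)"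
    by (intro Bochner_Integration.integral_sum integrable_mult_right intS)
  also have "\<dots> = (\<Sum>m\<le>N. a m * measure lborel (S m))"
    by (simp add: Bochner_Integration.integral_indicator)
  also have "\<dots> \<le> (\<Sum>m\<le>N. (2 ^ ?n * V) * (1 / 2) ^ m)"
  proof (rule sum_mono)
    fix m
    have "a m * measure lborel (S m) \<le> a m * (V * (2 ^ m) ^ CARD('d))"
      by (intro mult_left_mono S a)
    also have "\<dots> = (2 ^ ?n * V) * (1 / 2) ^ m"
      by (simp add: a_def power_divide)
    finally show "a m * measure lborel (S m) \<le> (2 ^ ?n * V) * (1 / 2) ^ m" .
  qed
  also have "\<dots> = (2 ^ ?n * V) * (\<Sum>m\<le>N. (1 / 2) ^ m)" by (simp add: sum_distrib_left)
  also have "\<dots> \<le> (2 ^ ?n * V) * 2"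
  proof (rule mult_left_mono)
    have "(\<Sum>m\<in>{..N}. (1 / 2 :: real) ^ m) \<le> (\<Sum>m. (1 / 2) ^ m)"
      by (rule sum_le_suminf) auto
    then show "(\<Sum>m\<le>N. (1 / 2 :: real) ^ m) \<le> 2" by (simp add: suminf_geometric)
  qed (use V in simp)
  also have "\<dots> = 2 ^ (CARD('d) + 2) * unit_ball_vol (real CARD('d)) * r ^ CARD('d) / L"
    by (simp add: V_def)
  finally show ?thesis .
qed

end

section \<open>The oscillatory integral estimate\<close>

text \<open>The first candidate in the maximum gives the power of \<open>lam\<close> exactly.  For the second, \<open>\<beta> \<ge> 1 / 2\<close>
yields both \<open>P powr (d / 2) \<le> 1 + P powr (d \<beta>)\<close> and \<open>lam powr (- d / 2) \<le> lam powr (- d (1 - \<beta>))\<close>.\<close>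

lemma scale_power_le:
  fixes P lam \<beta> :: real and d :: nat
  assumes "1 / 2 \<le> \<beta>" "1 \<le> lam" "0 < P" "0 < d"
  shows "max (lam powr (\<beta> - 1)) (sqrt (P / lam)) ^ d
    \<le> 2 * (1 + P powr (real d * \<beta>)) * lam powr (- (real d * (1 - \<beta>)))"
proof -
  let ?l = "lam powr (- (real d * (1 - \<beta>)))"
  have l: "0 \<le> ?l" by simp
  have 1: "(lam powr (\<beta> - 1)) ^ d = ?l"
    using assms by (simp add: powr_power algebra_simps)
  have "sqrt (P / lam) ^ d = ((P / lam) powr (1 / 2)) ^ d"
    using assms by (simp add: powr_half_sqrt)
  also have "\<dots> = (P / lam) powr (real d / 2)"
    using assms by (simp add: powr_power)
  also have "\<dots> = P powr (real d / 2) * lam powr (- (real d / 2))"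
    using assms by (simp add: powr_divide powr_minus_divide)
  also have "\<dots> \<le> (1 + P powr (real d * \<beta>)) * ?l"
  proof (rule mult_mono)
    show "P powr (real d / 2) \<le> 1 + P powr (real d * \<beta>)"
    proof (cases "P \<le> 1")
      case True
      then have "P powr (real d / 2) \<le> 1 powr (real d / 2)"
        using assms by (intro powr_mono2) auto
      then show ?thesis by (simp add: add_increasing2)
    next
      case False
      then have "P powr (real d / 2) \<le> P powr (real d * \<beta>)"
        using assms by (intro powr_mono) (auto simp: field_simps)
      then show ?thesis by simp
    qed
    have "real d * (1 - \<beta>) \<le> real d * (1 / 2)" using assms by (intro mult_left_mono) auto
    then show "lam powr (- (real d / 2)) \<le> ?l"
      using assms by (intro powr_mono) auto
  qed auto
  finally have 2: "sqrt (P / lam) ^ d \<le> (1 + P powr (real d * \<beta>)) * ?l" .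
  have "1 * ?l \<le> (1 + P powr (real d * \<beta>)) * ?l" by (intro mult_right_mono) auto
  with 1 2 have "max (lam powr (\<beta> - 1)) (sqrt (P / lam)) ^ d \<le> (1 + P powr (real d * \<beta>)) * ?l"
    by (auto simp: max_def)
  also have "\<dots> \<le> 2 * ((1 + P powr (real d * \<beta>)) * ?l)"
    by (simp add: add_nonneg_nonneg)
  finally show ?thesis by (simp only: mult.assoc)
qed

text \<open>The estimate with its explicit constant: the phase is put on the scale \<open>r\<close>, and the bound
combines lemmas \<open>decay\<close> (with \<open>p = 0\<close> and \<open>d + 1\<close> steps), \<open>mass_le\<close> and \<open>scale_power_le\<close>.\<close>

lemma oscillatory_integral_bound:
  fixes \<Phi> :: "real ^ 'd::finite \<Rightarrow> real" and \<psi> :: "real ^ 'd \<Rightarrow> complex"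
  assumes \<beta>: "1 / 2 \<le> \<beta>" and \<epsilon>: "0 < \<epsilon>"
    and pos: "1 \<le> lam" "0 < A" "0 < P"
    and C\<Phi>: "Ck_on (CARD('d) + 1) \<Phi> (ball 0 1)"
    and C\<psi>: "Cck_in (CARD('d) + 1) \<psi> (ball 0 (1 - \<epsilon>))"
    and b\<psi>: "\<And>x \<gamma>. x \<in> ball 0 1 \<Longrightarrow> mi_order \<gamma> \<le> CARD('d) + 1 \<Longrightarrow>
        norm (multi_deriv \<gamma> \<psi> x) \<le> A * lam powr (real (mi_order \<gamma>) * \<beta>)"
    and b\<Phi>: "\<And>x \<gamma>. x \<in> ball 0 1 \<Longrightarrow> 2 \<le> mi_order \<gamma> \<Longrightarrow> mi_order \<gamma> \<le> CARD('d) + 1 \<Longrightarrow>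
        \<bar>multi_deriv \<gamma> \<Phi> x\<bar> \<le> P * lam powr (\<beta> * (real (mi_order \<gamma>) - 2))"
    and inj: "inj_on (gradient \<Phi>) (ball 0 1)"
    and L: "0 < Lstar \<Phi>"
  shows "norm (LINT x|lborel. exp (\<i> * complex_of_real (lam * \<Phi> x)) * \<psi> x)
    \<le> ((1 + 2 * real CARD('d)) * (2 ^ CARD('d) * phase_const (real CARD('d)) CARD('d))) ^ (CARD('d) + 1)
        * 2 ^ (CARD('d) + 2) * unit_ball_vol (real CARD('d)) * 2 / Lstar \<Phi>
        * (1 + P powr (real CARD('d) * \<beta>)) * A * lam powr (- (real CARD('d) * (1 - \<beta>)))"
proof -
  let ?d = "CARD('d)"
  let ?U = "ball (0 :: real ^ 'd) 1"
  define r where "r = max (lam powr (\<beta> - 1)) (sqrt (P / lam))"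
  define \<mu> where "\<mu> = lam * r"
  define K where "K = closure {x. \<psi> x \<noteq> 0}"
  define G where "G i x = partial_deriv i \<Phi> x / r" for i x
  have r: "0 < r" using pos by (simp add: r_def less_max_iff_disj)
  have mu: "0 < \<mu>" using r pos by (simp add: \<mu>_def)
  have lam_mu: "lam powr \<beta> \<le> \<mu>"
  proof -
    have "lam powr \<beta> = lam * lam powr (\<beta> - 1)"
      using pos by (simp add: powr_diff)
    also have "\<dots> \<le> \<mu>" unfolding \<mu>_def r_def using pos by (intro mult_left_mono) auto
    finally show ?thesis .
  qed
  have P_mu: "P \<le> r * \<mu>"
  proof -
    have "sqrt (P / lam) * sqrt (P / lam) \<le> r * r"
      unfolding r_def using pos by (intro mult_mono) (auto simp: le_max_iff_disj)
    then have "P / lam \<le> r * r" using pos by simp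
    then show ?thesis using pos by (simp add: \<mu>_def divide_le_eq mult_ac)
  qed
  have pw: "lam powr (real n * \<beta>) \<le> \<mu> ^ n" for n
  proof -
    have "lam powr (real n * \<beta>) = (lam powr \<beta>) ^ n"
      using pos by (simp add: powr_power mult.commute)
    also have "\<dots> \<le> \<mu> ^ n" using lam_mu by (intro power_mono) auto
    finally show ?thesis .
  qed
  have d1: "?d + 1 = Suc (Suc (?d - 1))" by simp
  \<comment> \<open>\<open>P \<le> r * \<mu>\<close> absorbs the second derivatives; each further one costs \<open>lam powr \<beta> \<le> \<mu>\<close>.\<close>
  have jet\<Phi>: "jet_bound \<mu> ?U (?d - 1) (\<lambda>_. r * \<mu>) (partial_deriv k (partial_deriv i \<Phi>))" for i k
  proof -
    have "jet_bound \<mu> ?U (?d - 1) (\<lambda>_. r * \<mu>) (iter_partial [i, k] \<Phi>)"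
    proof (rule jet_bound_of_multi_deriv[where B = "\<lambda>n. P * lam powr (real n * \<beta>)"])
      show "Ck_on (length [i, k] + (?d - 1)) \<Phi> ?U" using C\<Phi> unfolding d1 by simp
      show "norm (multi_deriv \<gamma> \<Phi> x) \<le> P * lam powr (real (mi_order \<gamma> - length [i, k]) * \<beta>)"
        if "x \<in> ?U" "length [i, k] \<le> mi_order \<gamma>" "mi_order \<gamma> \<le> length [i, k] + (?d - 1)" for \<gamma> x
        using b\<Phi>[OF that(1), of \<gamma>] that(2,3) d1 by (simp add: of_nat_diff mult.commute)
      show "P * lam powr (real n * \<beta>) \<le> \<mu> ^ n * (r * \<mu>)" for n
        using mult_mono[OF P_mu pw[of n]] pos r mu by (simp add: mult_ac)
    qed auto
    then show ?thesis by simp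
  qed
  have C1: "Ck_on (Suc (?d - 1)) (partial_deriv i \<Phi>) ?U" for i
    using C\<Phi> unfolding d1 by simp
  have pdG: "has_partial k (G i) (partial_deriv k (partial_deriv i \<Phi>) x / r) x" if "x \<in> ?U" for i k x
    unfolding G_def[abs_def]
    by (rule has_partial_linear[OF bounded_linear_divide Ck_on_Suc_has_partial[OF C1 that]])
  have pdG': "partial_deriv k (G i) x = partial_deriv k (partial_deriv i \<Phi>) x / r" if "x \<in> ?U" for i k x
    using pdG[OF that] by (simp add: has_partial_iff)
  have K: "compact K" "K \<subseteq> ball 0 (1 - \<epsilon>)"
    using C\<psi> by (auto simp: Cck_in_def K_def)
  interpret scaled_phase \<Phi> G r \<mu> ?U K "phase_const (real ?d)"
  proof
    show "K \<subseteq> ?U" using K(2) \<epsilon> by (auto simp: subset_iff)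
    show "continuous_on ?U \<Phi>" using C\<Phi> by (rule Ck_on_continuous)
    show "has_partial i \<Phi> (r * G i x) x" if "x \<in> ?U" for i x
      using Ck_on_Suc_has_partial[of ?d \<Phi> ?U x i] C\<Phi> that r by (simp add: G_def)
    show "continuous_on ?U (G i)" for i
      unfolding G_def[abs_def] using r by (intro continuous_intros Ck_on_continuous[OF C1]) auto
    show "has_partial k (G i) (partial_deriv k (G i) x) x" if "x \<in> ?U" for i k x
      using pdG[OF that] by (simp add: has_partial_iff)
    show "jet_bound \<mu> ?U (?d - 1) (\<lambda>_. \<mu>) (partial_deriv k (G i))" for i k
    proof (rule jet_bound_cong[OF open_ball])
      have "jet_bound \<mu> ?U (?d - 1) (\<lambda>x. 1 / r * (r * \<mu>)) (\<lambda>x. partial_deriv k (partial_deriv i \<Phi>) x / r)"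
        by (rule jet_bound_linear[OF open_ball bounded_linear_divide _ _ jet\<Phi>]) (use r in auto)
      then show "jet_bound \<mu> ?U (?d - 1) (\<lambda>_. \<mu>) (\<lambda>x. partial_deriv k (partial_deriv i \<Phi>) x / r)"
        using r by simp
    qed (simp add: pdG')
  qed (use K r mu in auto)
  have jet\<psi>: "jet_bound \<mu> ?U (?d + 1) (\<lambda>x. A * w x ^ 0) \<psi>"
  proof -
    have "jet_bound \<mu> ?U (?d + 1) (\<lambda>_. A) (iter_partial [] \<psi>)"
    proof (rule jet_bound_of_multi_deriv[where B = "\<lambda>n. A * lam powr (real n * \<beta>)"])
      show "Ck_on (length [] + (?d + 1)) \<psi> ?U"
        using C\<psi> Ck_on_subset[of "?d + 1" \<psi> UNIV ?U] by (simp add: Cck_in_def)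
      show "A * lam powr (real n * \<beta>) \<le> \<mu> ^ n * A" for n
        using mult_left_mono[OF pw[of n], of A] pos by (simp add: mult.commute)
    qed (use b\<psi> in auto)
    then show ?thesis by simp
  qed
  have osc: "osc x = exp (\<i> * complex_of_real (lam * \<Phi> x))" for x
    unfolding osc_def using r by (simp add: \<mu>_def)
  have supp: "supported \<psi>"
    unfolding supported_def using closure_subset[of "{x. \<psi> x \<noteq> 0}"] by (auto simp: K_def)
  have decay\<psi>: "norm (LINT x|lborel. osc x * \<psi> x) \<le> step_const ^ (?d + 1) * A * mass"
    by (rule decay[OF _ _ _ jet\<psi> supp]) (use pos in auto)
  have "mass \<le> 2 ^ (?d + 2) * unit_ball_vol (real ?d) * r ^ ?d / Lstar \<Phi>"
  proof (rule mass_le[OF bounded_ball _ L])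
    have "r *\<^sub>R \<Gamma> x = gradient \<Phi> x" for x
      using r by (simp add: \<Gamma>_def gradient_def G_def vec_eq_iff)
    then show "inj_on (\<lambda>x. r *\<^sub>R \<Gamma> x) ?U" using inj by simp
    fix x assume x: "x \<in> ?U"
    \<comment> \<open>The Jacobian matrix of the gradient has the indices of the Hessian swapped.\<close>
    have "(\<chi> i k. r * partial_deriv k (G i) x) = transpose (hessian \<Phi> x)"
      using r by (simp add: hessian_def transpose_def pdG'[OF x])
    moreover have "Lstar \<Phi> \<le> \<bar>det (hessian \<Phi> x)\<bar>"
      unfolding Lstar_def by (rule cINF_lower[OF _ x]) (rule bdd_belowI[of _ 0], auto)
    ultimately show "Lstar \<Phi> \<le> \<bar>det (\<chi> i k. r * partial_deriv k (G i) x)\<bar>"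
      by (simp add: det_transpose)
  qed
  also have "\<dots> \<le> 2 ^ (?d + 2) * unit_ball_vol (real ?d) *
      (2 * (1 + P powr (real ?d * \<beta>)) * lam powr (- (real ?d * (1 - \<beta>)))) / Lstar \<Phi>"
    unfolding r_def
    by (intro divide_right_mono mult_left_mono scale_power_le \<beta> pos) (use L in auto)
  finally have "step_const ^ (?d + 1) * A * mass \<le> step_const ^ (?d + 1) * A * (2 ^ (?d + 2) * unit_ball_vol (real ?d) *
      (2 * (1 + P powr (real ?d * \<beta>)) * lam powr (- (real ?d * (1 - \<beta>)))) / Lstar \<Phi>)"
    using step_const_ge_1 pos by (intro mult_left_mono) auto
  also have "g * A * (a * u * (2 * y * l) / M) = g * a * u * 2 / M * y * A * l" for g a u y l M :: real
    by (simp add: divide_inverse mult_ac)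
  finally show ?thesis
    using decay\<psi> unfolding osc step_const_def cD_def by (rule order_trans[rotated])
qed

theorem theorem1p3:
  fixes \<beta> \<epsilon>\<^sub>0 :: real
  assumes "1 / 2 \<le> \<beta>" and "\<beta> < 1" and "0 < \<epsilon>\<^sub>0" and "\<epsilon>\<^sub>0 < 1"
  shows "\<exists>C::real. \<forall>(lam::real) (A::real) (P::real)
           (\<Phi> :: real ^ 'd::finite \<Rightarrow> real) (\<psi> :: real ^ 'd \<Rightarrow> complex).
     lam \<ge> 1 \<longrightarrow> A > 0 \<longrightarrow> P > 0 \<longrightarrow>
     Ck_on (CARD('d) + 1) \<Phi> (ball 0 1) \<longrightarrow>
     Cck_in (CARD('d) + 1) \<psi> (ball 0 (1 - \<epsilon>\<^sub>0)) \<longrightarrow>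
     (\<forall>x\<in>ball 0 1. \<forall>\<gamma>. mi_order \<gamma> \<le> CARD('d) + 1 \<longrightarrow>
        norm (multi_deriv \<gamma> \<psi> x) \<le> A * lam powr (real (mi_order \<gamma>) * \<beta>)) \<longrightarrow>
     (\<forall>x\<in>ball 0 1. \<forall>\<gamma>. 2 \<le> mi_order \<gamma> \<and> mi_order \<gamma> \<le> CARD('d) + 1 \<longrightarrow>
        \<bar>multi_deriv \<gamma> \<Phi> x\<bar> \<le> P * lam powr (\<beta> * (real (mi_order \<gamma>) - 2))) \<longrightarrow>
     inj_on (gradient \<Phi>) (ball 0 1) \<longrightarrow>
     Lstar \<Phi> > 0 \<longrightarrow>
     norm (LINT x|lborel. exp (\<i> * complex_of_real (lam * \<Phi> x)) * \<psi> x)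
       \<le> C / Lstar \<Phi> * (1 + P powr (real CARD('d) * \<beta>)) * A
           * lam powr (- (real CARD('d) * (1 - \<beta>)))"
  by (intro exI allI impI, rule oscillatory_integral_bound[OF assms(1) assms(3)]) blast+

end
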